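(* Let $\alpha_0,\lambda_0\in\mathbb R$ and let $u\in\mathcal S(\mathbb R)$ satisfy $\|u\|_{L^2(\mathbb R)}=1$, $u(x)=0$ if and only if $x=\lambda_0$, and $1+\alpha_0\gamma(|u|^2,\lambda_0)=0$. For $\alpha\in\mathbb R$ let $H_\alpha=M_x+\alpha\langle\cdot,u\rangle u$ on $L^2(\mathbb R)$. Suppose $u$ vanishes to order $n$ at $x=\lambda_0$ ($n\ge1$ an integer). Then for any $p\in[0,2n)$, the spectrum of $H_\alpha$ is concentrated near $\lambda_0$ to order $p$ as $\alpha\to\alpha_0$.
   Context: The inner product is linear in its first argument. $M_x$ is the self-adjoint operator of multiplication by $x$ on $L^2(\mathbb R)$, with maximal domain; $H_\alpha$ has the same domain. For $f\in\mathcal S(\mathbb R)$, $\lambda\in\mathbb R$, $\gamma(f,\lambda)=\lim_{\epsilon\to0^+}\int_{|x-\lambda|\ge\epsilon}\frac{f(x)}{x-\lambda}\,dx$ (Cauchy principal value). Under these hypotheses $\lambda_0$ is a simple eigenvalue of $H_{\alpha_0}$. "$u$ vanishes to order $n$ at $\lambda_0$" means $u^{(j)}(\lambda_0)=0$ for $0\le j\le n-1$. Spectral concentration: let $\{T_\alpha\}_{\alpha\in\mathbb R}$ be a family of self-adjoint operators in a Hilbert space with spectral measures $E_\alpha$, and let $\lambda_0$ be an eigenvalue of $T_{\alpha_0}$. The spectrum of $T_\alpha$ is concentrated near $\lambda_0$ to order $p$ as $\alpha\to\alpha_0$ if there is a family $\{J_\alpha\}$ of Borel subsets of $\mathbb R$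 whose Lebesgue measures satisfy $|J_\alpha|\to0$ and $|J_\alpha|/|\alpha-\alpha_0|^p\to0$, and such that $E_\alpha(J_\alpha)\to E_{\alpha_0}(\{\lambda_0\})$ strongly, as $\alpha\to\alpha_0$ ($\alpha\ne\alpha_0$). *)

theory Defs
  imports "HOL-Analysis.Analysis"
begin

section \<open>The Hilbert space of square-integrable functions on the line\<close>

definition square_integrable :: "(real \<Rightarrow> complex) \<Rightarrow> bool" where
  "square_integrable f \<longleftrightarrow>
     f \<in> borel_measurable lborel \<and> integrable lborel (\<lambda>x. (cmod (f x))\<^sup>2)"

lemma square_integrable_zero: "square_integrable (\<lambda>_. 0)"
  by (simp add: square_integrable_def)

lemma square_integrable_scale:
  assumes "square_integrable f"
  shows "square_integrable (\<lambda>x. c * f x)"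
  using assms by (auto simp: square_integrable_def norm_mult power_mult_distrib)

lemma square_integrable_add:
  assumes "square_integrable f" "square_integrable g"
  shows "square_integrable (\<lambda>x. f x + g x)"
  unfolding square_integrable_def
proof
  have [measurable]: "f \<in> borel_measurable lborel" "g \<in> borel_measurable lborel"
    using assms by (auto simp: square_integrable_def)
  show "(\<lambda>x. f x + g x) \<in> borel_measurable lborel" by measurable
  have bound: "(cmod (a + b))\<^sup>2 \<le> 2 * (cmod a)\<^sup>2 + 2 * (cmod b)\<^sup>2" for a b :: complex
  proof -
    have "(cmod (a + b))\<^sup>2 \<le> (cmod a + cmod b)\<^sup>2"
      by (intro power_mono norm_triangle_ineq) auto
    also have "\<dots> \<le> 2 * (cmod a)\<^sup>2 + 2 * (cmod b)\<^sup>2"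
      using sum_squares_bound[of "cmod a" "cmod b"] by (simp add: power2_sum)
    finally show ?thesis .
  qed
  show "integrable lborel (\<lambda>x. (cmod (f x + g x))\<^sup>2)"
    by (rule Bochner_Integration.integrable_bound
          [of _ "\<lambda>x. 2 * (cmod (f x))\<^sup>2 + 2 * (cmod (g x))\<^sup>2"])
       (use assms bound in \<open>auto simp: square_integrable_def\<close>)
qed

lemma square_integrable_uminus:
  "square_integrable f \<Longrightarrow> square_integrable (\<lambda>x. - f x)"
  using square_integrable_scale[of f "-1"] by simp

lemma square_integrable_diff:
  "square_integrable f \<Longrightarrow> square_integrable g \<Longrightarrow> square_integrable (\<lambda>x. f x - g x)"
  using square_integrable_add[of f "\<lambda>x. - g x"] square_integrable_uminus[of g] by simp

lemma square_integrable_mult_cnj: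
  assumes "square_integrable f" "square_integrable g"
  shows "integrable lborel (\<lambda>x. f x * cnj (g x))"
proof -
  have [measurable]: "f \<in> borel_measurable lborel" "g \<in> borel_measurable lborel"
    using assms by (auto simp: square_integrable_def)
  have bound: "cmod a * cmod b \<le> (cmod a)\<^sup>2 + (cmod b)\<^sup>2" for a b :: complex
  proof -
    have "2 * (cmod a * cmod b) \<le> (cmod a)\<^sup>2 + (cmod b)\<^sup>2"
      using sum_squares_bound[of "cmod a" "cmod b"] by (simp add: mult.assoc)
    moreover have "0 \<le> cmod a * cmod b" by simp
    ultimately show ?thesis by linarith
  qed
  have "(\<lambda>x. cnj (g x)) \<in> borel_measurable lborel"
    by (rule borel_measurable_continuous_on[OF continuous_on_cnj[OF continuous_on_id]]) simp
  then have "(\<lambda>x. f x * cnj (g x)) \<in> borel_measurable lborel" by simp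
  then show ?thesis
    by (rule Bochner_Integration.integrable_bound
          [of _ "\<lambda>x. (cmod (f x))\<^sup>2 + (cmod (g x))\<^sup>2", rotated])
       (use assms bound in \<open>auto simp: square_integrable_def norm_mult\<close>)
qed

definition L2_rel :: "(real \<Rightarrow> complex) \<Rightarrow> (real \<Rightarrow> complex) \<Rightarrow> bool" where
  "L2_rel f g \<longleftrightarrow> square_integrable f \<and> square_integrable g \<and> (AE x in lborel. f x = g x)"

lemma part_equivp_L2_rel: "part_equivp L2_rel"
proof (rule part_equivpI)
  show "\<exists>f. L2_rel f f" using square_integrable_zero by (auto simp: L2_rel_def)
  show "symp L2_rel" by (rule sympI) (auto simp: L2_rel_def eq_commute)
  show "transp L2_rel" by (rule transpI) (auto simp: L2_rel_def)
qed

quotient_type L2 = "real \<Rightarrow> complex" / partial: L2_rel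
  by (rule part_equivp_L2_rel)

text \<open>\<^term>\<open>abs_L2 f\<close> is the class of a square-integrable \<^term>\<open>f\<close> (and unspecified otherwise);
  \<^term>\<open>rep_L2\<close> chooses a representative.\<close>

lemma square_integrable_rep_L2: "square_integrable (rep_L2 f)"
  using Quotient3_rep_reflp[OF Quotient3_L2, of f] by (simp add: L2_rel_def)

lemma abs_rep_L2: "abs_L2 (rep_L2 f) = f"
  by (rule Quotient3_abs_rep[OF Quotient3_L2])

lemma rep_abs_L2:
  assumes "square_integrable f"
  shows "AE x in lborel. rep_L2 (abs_L2 f) x = f x"
  using rep_abs_rsp_left[OF Quotient3_L2, of f f] assms by (auto simp: L2_rel_def)

instantiation L2 :: ab_group_add
begin
lift_definition zero_L2 :: L2 is "\<lambda>_. 0"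
  by (simp add: L2_rel_def square_integrable_zero)
lift_definition plus_L2 :: "L2 \<Rightarrow> L2 \<Rightarrow> L2" is "\<lambda>f g x. f x + g x"
  by (auto simp: L2_rel_def square_integrable_add)
lift_definition minus_L2 :: "L2 \<Rightarrow> L2 \<Rightarrow> L2" is "\<lambda>f g x. f x - g x"
  by (auto simp: L2_rel_def square_integrable_diff)
lift_definition uminus_L2 :: "L2 \<Rightarrow> L2" is "\<lambda>f x. - f x"
  by (auto simp: L2_rel_def square_integrable_uminus)
instance
  by standard (transfer; auto simp: L2_rel_def algebra_simps square_integrable_zero
      square_integrable_add square_integrable_diff square_integrable_uminus)+
end

lift_definition scaleC :: "complex \<Rightarrow> L2 \<Rightarrow> L2" (infixr "*\<^sub>C" 75) is "\<lambda>c f x. c * f x"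
  by (auto simp: L2_rel_def square_integrable_scale)

lift_definition cinner :: "L2 \<Rightarrow> L2 \<Rightarrow> complex" is
  "\<lambda>f g. LINT x|lborel. f x * cnj (g x)"
proof -
  fix f f' g g' assume *: "L2_rel f f'" "L2_rel g g'"
  then have "(\<lambda>x. f x * cnj (g x)) \<in> borel_measurable lborel"
    "(\<lambda>x. f' x * cnj (g' x)) \<in> borel_measurable lborel"
    using borel_measurable_integrable[OF square_integrable_mult_cnj[of f g]]
      borel_measurable_integrable[OF square_integrable_mult_cnj[of f' g']]
    by (auto simp: L2_rel_def)
  with * show "(LINT x|lborel. f x * cnj (g x)) = (LINT x|lborel. f' x * cnj (g' x))"
    by (intro integral_cong_AE) (auto simp: L2_rel_def)
qed

lemma cinner_add_left: "cinner (f + g) h = cinner f h + cinner g h"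
proof (transfer, goal_cases)
  case (1 f g h)
  then show ?case
    using Bochner_Integration.integral_add
      [OF square_integrable_mult_cnj[of f h] square_integrable_mult_cnj[of g h]]
    by (simp add: L2_rel_def distrib_right)
qed

lemma cinner_scaleC_left: "cinner (c *\<^sub>C f) g = c * cinner f g"
  by transfer (simp add: mult.assoc)

lemma cinner_commute: "cinner f g = cnj (cinner g f)"
proof (transfer, goal_cases)
  case (1 f g)
  have "cnj (LINT x|lborel. g x * cnj (f x)) = (LINT x|lborel. cnj (g x * cnj (f x)))"
    by (rule integral_bounded_linear'[OF bounded_linear_cnj bounded_linear_cnj, symmetric]) simp
  then show ?case by (simp add: mult.commute)
qed

lemma cinner_self: "cinner f f = of_real (LINT x|lborel. (cmod (rep_L2 f x))\<^sup>2)"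
proof -
  have "cinner f f = (LINT x|lborel. rep_L2 f x * cnj (rep_L2 f x))"
    using cinner.abs_eq[of "rep_L2 f" "rep_L2 f"] square_integrable_rep_L2[of f]
    by (simp add: abs_rep_L2 eq_onp_def L2_rel_def)
  also have "\<dots> = (LINT x|lborel. of_real ((cmod (rep_L2 f x))\<^sup>2))"
    by (simp only: complex_norm_square)
  also have "\<dots> = of_real (LINT x|lborel. (cmod (rep_L2 f x))\<^sup>2)"
    by (rule integral_complex_of_real)
  finally show ?thesis .
qed

lemma cinner_self_eq_0: "cinner f f = 0 \<Longrightarrow> f = 0"
proof -
  assume "cinner f f = 0"
  then have "(LINT x|lborel. (cmod (rep_L2 f x))\<^sup>2) = 0"
    by (simp only: cinner_self of_real_eq_0_iff)
  then have "AE x in lborel. (cmod (rep_L2 f x))\<^sup>2 = 0"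
    using square_integrable_rep_L2[of f]
    by (subst (asm) integral_nonneg_eq_0_iff_AE) (auto simp: square_integrable_def)
  then have "L2_rel (rep_L2 f) (\<lambda>_. 0)"
    using square_integrable_rep_L2[of f] square_integrable_zero by (auto simp: L2_rel_def)
  then have "abs_L2 (rep_L2 f) = abs_L2 (\<lambda>_. 0)"
    by (rule Quotient3_rel_abs[OF Quotient3_L2])
  then show "f = 0" by (simp add: abs_rep_L2 zero_L2_def)
qed

text \<open>The real inner product \<open>Re \<langle>f, g\<rangle>\<close> induces the usual norm and topology.\<close>

instantiation L2 :: real_inner
begin
definition scaleR_L2 :: "real \<Rightarrow> L2 \<Rightarrow> L2" where "scaleR_L2 r f = of_real r *\<^sub>C f"
definition inner_L2 :: "L2 \<Rightarrow> L2 \<Rightarrow> real" where "inner_L2 f g = Re (cinner f g)"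
definition norm_L2 :: "L2 \<Rightarrow> real" where "norm_L2 f = sqrt (inner f f)"
definition dist_L2 :: "L2 \<Rightarrow> L2 \<Rightarrow> real" where "dist_L2 f g = norm (f - g)"
definition sgn_L2 :: "L2 \<Rightarrow> L2" where "sgn_L2 f = inverse (norm f) *\<^sub>R f"
definition uniformity_L2 :: "(L2 \<times> L2) filter" where
  "uniformity_L2 = (INF e\<in>{0<..}. principal {(f, g). dist f g < e})"
definition open_L2 :: "L2 set \<Rightarrow> bool" where
  "open_L2 U \<longleftrightarrow> (\<forall>x\<in>U. \<forall>\<^sub>F (x', y) in uniformity. x' = x \<longrightarrow> y \<in> U)"
instance
proof
  fix f g h :: L2 and a b r :: real
  show "a *\<^sub>R (f + g) = a *\<^sub>R f + a *\<^sub>R g" unfolding scaleR_L2_def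
    by transfer (auto simp: L2_rel_def distrib_left distrib_right
        intro!: square_integrable_scale square_integrable_add)
  show "(a + b) *\<^sub>R f = a *\<^sub>R f + b *\<^sub>R f" unfolding scaleR_L2_def
    by transfer (auto simp: L2_rel_def distrib_left distrib_right
        intro!: square_integrable_scale square_integrable_add)
  show "a *\<^sub>R b *\<^sub>R f = (a * b) *\<^sub>R f" unfolding scaleR_L2_def
    by transfer (auto simp: L2_rel_def mult.assoc intro!: square_integrable_scale)
  show "1 *\<^sub>R f = f" unfolding scaleR_L2_def
    by transfer (auto simp: L2_rel_def)
  show "inner f g = inner g f"
    unfolding inner_L2_def by (subst cinner_commute) simp
  show "inner (f + g) h = inner f h + inner g h"
    by (simp add: inner_L2_def cinner_add_left)
  show "inner (r *\<^sub>R f) g = r * inner f g"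
    by (simp add: inner_L2_def scaleR_L2_def cinner_scaleC_left)
  show "0 \<le> inner f f"
    by (simp add: inner_L2_def cinner_self)
  have "cinner f f = 0" if "Re (cinner f f) = 0"
    using that by (simp add: cinner_self)
  moreover have "cinner (0::L2) 0 = 0"
    using cinner_add_left[of 0 0 0] by simp
  ultimately show "inner f f = 0 \<longleftrightarrow> f = 0"
    using cinner_self_eq_0[of f] by (auto simp: inner_L2_def)
  show "norm f = sqrt (inner f f)" by (rule norm_L2_def)
qed (fact dist_L2_def sgn_L2_def uniformity_L2_def open_L2_def)+
end


section \<open>Unbounded operators and their spectral measures\<close>

text \<open>Operators are identified with their graphs.  The equation \<open>T = adjoint T\<close> forces \<open>T\<close> to be
  a (closed) linear subspace, and density of the domain makes it single-valued.\<close>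

type_synonym L2_operator = "(L2 \<times> L2) set"

definition adjoint :: "L2_operator \<Rightarrow> L2_operator" where
  "adjoint T = {(f, g). \<forall>(h, k)\<in>T. cinner k f = cinner h g}"

definition selfadjoint :: "L2_operator \<Rightarrow> bool" where
  "selfadjoint T \<longleftrightarrow> closure (Domain T) = UNIV \<and> T = adjoint T"

definition eigenvalue :: "L2_operator \<Rightarrow> real \<Rightarrow> bool" where
  "eigenvalue T l \<longleftrightarrow> (\<exists>f. f \<noteq> 0 \<and> (f, of_real l *\<^sub>C f) \<in> T)"

definition orthogonal_projection :: "(L2 \<Rightarrow> L2) \<Rightarrow> bool" where
  "orthogonal_projection P \<longleftrightarrow>
     (\<forall>f g. P (f + g) = P f + P g) \<and> (\<forall>c f. P (c *\<^sub>C f) = c *\<^sub>C P f) \<and>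
     (\<forall>f. P (P f) = P f) \<and> (\<forall>f g. cinner (P f) g = cinner f (P g))"

definition projection_valued_measure :: "(real set \<Rightarrow> L2 \<Rightarrow> L2) \<Rightarrow> bool" where
  "projection_valued_measure E \<longleftrightarrow>
     (\<forall>B\<in>sets borel. orthogonal_projection (E B)) \<and>
     (\<forall>f. E {} f = 0) \<and> (\<forall>f. E UNIV f = f) \<and>
     (\<forall>A\<in>sets borel. \<forall>B\<in>sets borel. \<forall>f. E (A \<inter> B) f = E A (E B f)) \<and>
     (\<forall>A :: nat \<Rightarrow> real set. range A \<subseteq> sets borel \<longrightarrow> disjoint_family A \<longrightarrow>
        (\<forall>f. (\<lambda>i. E (A i) f) sums E (\<Union>i. A i) f))"

definition scalar_spectral_measure :: "(real set \<Rightarrow> L2 \<Rightarrow> L2) \<Rightarrow> L2 \<Rightarrow> real measure" where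
  "scalar_spectral_measure E f =
     measure_of UNIV (sets borel) (\<lambda>B. ennreal (Re (cinner (E B f) f)))"

text \<open>\<open>T = \<integral> x dE(x)\<close>: the domain of \<open>T\<close> consists of the \<open>f\<close> with \<open>\<integral> x\<^sup>2 d\<langle>E(x) f, f\<rangle> < \<infinity>\<close>, and
  \<open>\<langle>T f, f\<rangle> = \<integral> x d\<langle>E(x) f, f\<rangle>\<close> there, which by polarization determines \<open>T\<close>.\<close>

definition spectral_measure :: "L2_operator \<Rightarrow> (real set \<Rightarrow> L2 \<Rightarrow> L2) \<Rightarrow> bool" where
  "spectral_measure T E \<longleftrightarrow>
     projection_valued_measure E \<and>
     Domain T = {f. integrable (scalar_spectral_measure E f) (\<lambda>x. x\<^sup>2)} \<and>
     (\<forall>(f, g)\<in>T. cinner g f = of_real (LINT x|scalar_spectral_measure E f. x))"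

text \<open>Lebesgue measure is taken in the extended nonnegative reals, so that sets of infinite measure
  are not treated as null sets.\<close>

definition spectrum_concentrated ::
  "(real \<Rightarrow> L2_operator) \<Rightarrow> (real \<Rightarrow> real set \<Rightarrow> L2 \<Rightarrow> L2) \<Rightarrow> real \<Rightarrow> real \<Rightarrow> real \<Rightarrow> bool" where
  "spectrum_concentrated T E l0 a0 p \<longleftrightarrow>
     (\<forall>a. selfadjoint (T a) \<and> spectral_measure (T a) (E a)) \<and>
     eigenvalue (T a0) l0 \<and>
     (\<exists>J :: real \<Rightarrow> real set.
        (\<forall>a. J a \<in> sets borel) \<and>
        ((\<lambda>a. emeasure lborel (J a)) \<longlongrightarrow> 0) (at a0) \<and>
        ((\<lambda>a. emeasure lborel (J a) / ennreal (\<bar>a - a0\<bar> powr p)) \<longlongrightarrow> 0) (at a0) \<and>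
        (\<forall>f. ((\<lambda>a. E a (J a) f) \<longlongrightarrow> E a0 {l0} f) (at a0)))"


section \<open>The perturbed multiplication operator\<close>

definition nth_derivative :: "nat \<Rightarrow> (real \<Rightarrow> complex) \<Rightarrow> real \<Rightarrow> complex" where
  "nth_derivative j = ((\<lambda>f x. vector_derivative f (at x)) ^^ j)"

definition schwartz :: "(real \<Rightarrow> complex) \<Rightarrow> bool" where
  "schwartz f \<longleftrightarrow>
     (\<forall>j x. nth_derivative j f differentiable (at x)) \<and>
     (\<forall>j k. bounded (range (\<lambda>x. of_real (x ^ k) * nth_derivative j f x)))"

definition vanishes_to_order :: "(real \<Rightarrow> complex) \<Rightarrow> nat \<Rightarrow> real \<Rightarrow> bool" where
  "vanishes_to_order f n x0 \<longleftrightarrow> (\<forall>j<n. nth_derivative j f x0 = 0)"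

definition pv_integral :: "(real \<Rightarrow> complex) \<Rightarrow> real \<Rightarrow> complex" where
  "pv_integral f l =
     Lim (at_right 0) (\<lambda>e. LINT x:{x. \<bar>x - l\<bar> \<ge> e}|lborel. f x / of_real (x - l))"

definition mult_x :: L2_operator where
  "mult_x = {(f, g). AE x in lborel. rep_L2 g x = of_real x * rep_L2 f x}"

definition H :: "(real \<Rightarrow> complex) \<Rightarrow> real \<Rightarrow> L2_operator" where
  "H u a = {(f, g + of_real a *\<^sub>C (cinner f (abs_L2 u) *\<^sub>C abs_L2 u)) | f g. (f, g) \<in> mult_x}"

end

theory Submission
  imports Defs "HOL-Probability.Sinc_Integral"
begin

text \<open>The eigenvector of \<open>H\<^sub>\<alpha>\<^sub>0\<close> is \<open>f\<^sub>0 = u / (x - \<lambda>\<^sub>0)\<close>.  For \<open>s = |\<alpha> - \<alpha>\<^sub>0|\<close> put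
  \<open>d = s\<^sup>r\<close> with \<open>max p 1 < r < 2n\<close> and truncate the Cauchy kernel \<open>1 / (x - \<lambda>)\<close> to a bounded
  kernel \<open>k\<close> that differs from it only where \<open>|x - \<lambda>| < d\<close>.  The intermediate value theorem gives a
  \<open>\<lambda>\<close> with \<open>|\<lambda> - \<lambda>\<^sub>0| = O(s)\<close> and \<open>1 + \<alpha> \<integral> |u|\<^sup>2 k(x - \<lambda>) dx = 0\<close>.  Then \<open>u k(x - \<lambda>)\<close>
  converges to \<open>f\<^sub>0\<close>, and its residual under \<open>H\<^sub>\<alpha> - \<lambda>\<close> lives on \<open>|x - \<lambda>| < d\<close>, where
  \<open>|u| = O(s\<^sup>n)\<close>; so the residual has norm \<open>O(s\<^sup>n sqrt d) = o(d)\<close> and the spectral projection of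
  the interval \<open>J = (\<lambda> - d, \<lambda> + d)\<close> almost fixes the approximate eigenvector.  On the range of
  \<open>H\<^sub>\<alpha>\<^sub>0 - \<lambda>\<^sub>0\<close> these projections tend strongly to 0 because \<open>J\<close> shrinks to \<open>\<lambda>\<^sub>0\<close>
  and the perturbation is bounded, and that range is dense in the orthogonal complement of \<open>f\<^sub>0\<close>.\<close>

section \<open>Square-integrable functions and their classes\<close>

lemma square_integrable_measurable [measurable_dest]:
  "square_integrable f \<Longrightarrow> f \<in> borel_measurable borel"
  by (simp add: square_integrable_def)

lemma square_integrable_integrable:
  "square_integrable f \<Longrightarrow> integrable lborel (\<lambda>x. (cmod (f x))\<^sup>2)"
  by (simp add: square_integrable_def)

lemma square_integrable_bound:
  assumes "f \<in> borel_measurable borel" and "integrable lborel g"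
    and "\<And>x. (cmod (f x))\<^sup>2 \<le> g x"
  shows "square_integrable f"
  unfolding square_integrable_def
proof
  show "f \<in> borel_measurable lborel" using assms(1) by simp
  then have "(\<lambda>x. (cmod (f x))\<^sup>2) \<in> borel_measurable lborel" by measurable
  moreover have "norm ((cmod (f x))\<^sup>2) \<le> norm (g x)" for x
    using assms(3)[of x] by simp
  ultimately show "integrable lborel (\<lambda>x. (cmod (f x))\<^sup>2)"
    by (intro Bochner_Integration.integrable_bound[OF assms(2)]) auto
qed

lemma square_integrable_dominated:
  assumes "f \<in> borel_measurable borel" and "square_integrable g"
    and "\<And>x. cmod (f x) \<le> c * cmod (g x)"
  shows "square_integrable f"
proof (rule square_integrable_bound[OF assms(1)])
  show "integrable lborel (\<lambda>x. c\<^sup>2 * (cmod (g x))\<^sup>2)"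
    using square_integrable_integrable[OF assms(2)] by simp
  show "(cmod (f x))\<^sup>2 \<le> c\<^sup>2 * (cmod (g x))\<^sup>2" for x
    using power_mono[OF assms(3)[of x], of 2] by (simp add: power_mult_distrib)
qed

lemma L2_rel_self: "square_integrable f \<Longrightarrow> L2_rel f f"
  by (simp add: L2_rel_def)

lemma abs_L2_eqI:
  assumes "square_integrable f" "square_integrable g" "AE x in lborel. f x = g x"
  shows "abs_L2 f = abs_L2 g"
  using assms by (intro Quotient3_rel_abs[OF Quotient3_L2]) (simp add: L2_rel_def)

lemma L2_cases:
  obtains f where "square_integrable f" "F = abs_L2 f"
  using square_integrable_rep_L2[of F] abs_rep_L2[of F] by metis

lemma abs_L2_diff:
  "square_integrable f \<Longrightarrow> square_integrable g \<Longrightarrow> abs_L2 f - abs_L2 g = abs_L2 (\<lambda>x. f x - g x)"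
  by (simp add: minus_L2.abs_eq L2_rel_self eq_onp_def)

lemma abs_L2_scaleC:
  "square_integrable f \<Longrightarrow> c *\<^sub>C abs_L2 f = abs_L2 (\<lambda>x. c * f x)"
  by (simp add: scaleC.abs_eq L2_rel_self eq_onp_def)

lemma cinner_abs_L2:
  "square_integrable f \<Longrightarrow> square_integrable g \<Longrightarrow>
    cinner (abs_L2 f) (abs_L2 g) = (LINT x|lborel. f x * cnj (g x))"
  by (simp add: cinner.abs_eq L2_rel_self eq_onp_def)

lemma cinner_self_norm: "cinner f f = of_real ((norm f)\<^sup>2)"
  using cinner_self[of f]
  by (simp add: power2_norm_eq_inner inner_L2_def)

lemma norm_abs_L2:
  assumes "square_integrable f"
  shows "(norm (abs_L2 f))\<^sup>2 = (LINT x|lborel. (cmod (f x))\<^sup>2)"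
proof -
  have "complex_of_real ((norm (abs_L2 f))\<^sup>2) = (LINT x|lborel. of_real ((cmod (f x))\<^sup>2))"
    using cinner_abs_L2[OF assms assms] unfolding cinner_self_norm
    by (simp only: complex_norm_square)
  also have "\<dots> = of_real (LINT x|lborel. (cmod (f x))\<^sup>2)"
    by (rule integral_complex_of_real)
  finally show ?thesis by (simp only: of_real_eq_iff)
qed

section \<open>Algebra and Cauchy-Schwarz inequality of the complex inner product\<close>

lemma cinner_add_right: "cinner f (g + h) = cinner f g + cinner f h"
  by (metis cinner_add_left cinner_commute complex_cnj_add)

lemma cinner_scaleC_right: "cinner f (c *\<^sub>C g) = cnj c * cinner f g"
  by (metis cinner_scaleC_left cinner_commute complex_cnj_mult)

lemma cinner_zero_left [simp]: "cinner 0 f = 0"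
  using cinner_add_left[of 0 0 f] by simp

lemma cinner_zero_right [simp]: "cinner f 0 = 0"
  by (metis cinner_zero_left cinner_commute complex_cnj_zero)

lemma cinner_minus_left: "cinner (- f) g = - cinner f g"
  by (metis add.right_inverse add_eq_0_iff cinner_add_left cinner_zero_left)

lemma cinner_minus_right: "cinner f (- g) = - cinner f g"
  by (metis cinner_minus_left cinner_commute complex_cnj_minus)

lemma cinner_diff_left: "cinner (f - g) h = cinner f h - cinner g h"
  using cinner_add_left[of f "- g" h] by (simp add: cinner_minus_left)

lemma cinner_diff_right: "cinner f (g - h) = cinner f g - cinner f h"
  using cinner_add_right[of f g "- h"] by (simp add: cinner_minus_right)

lemmas cinner_simps = cinner_add_left cinner_add_right cinner_diff_left cinner_diff_right
  cinner_scaleC_left cinner_scaleC_right cinner_minus_left cinner_minus_right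

lemma scaleC_add_right: "c *\<^sub>C (f + g) = c *\<^sub>C f + c *\<^sub>C g"
  by transfer (auto simp: L2_rel_def distrib_left
      intro!: square_integrable_scale square_integrable_add)

lemma scaleC_scaleC: "c *\<^sub>C d *\<^sub>C f = (c * d) *\<^sub>C f"
  by transfer (auto simp: L2_rel_def mult.assoc intro!: square_integrable_scale)

lemma scaleC_of_real: "of_real r *\<^sub>C (f :: L2) = r *\<^sub>R f"
  by (simp add: scaleR_L2_def)

lemma scaleC_minus_one: "(-1) *\<^sub>C (f :: L2) = - f"
  by transfer (auto simp: L2_rel_def intro!: square_integrable_uminus)

lemma norm_scaleC: "norm (c *\<^sub>C f) = cmod c * norm (f :: L2)"
proof -
  have "complex_of_real ((norm (c *\<^sub>C f))\<^sup>2) = of_real ((cmod c * norm f)\<^sup>2)"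
    unfolding cinner_self_norm[symmetric] cinner_scaleC_left cinner_scaleC_right
    by (simp add: cinner_self_norm power_mult_distrib mult.assoc[symmetric] complex_norm_square
        del: of_real_power)
  then have "(norm (c *\<^sub>C f))\<^sup>2 = (cmod c * norm f)\<^sup>2"
    by (simp only: of_real_eq_iff)
  then show ?thesis by simp
qed

lemma cinner_Cauchy_Schwarz: "cmod (cinner f g) \<le> norm f * norm g"
proof -
  \<comment> \<open>This phase rotates \<open>cinner f g\<close> onto the nonnegative real axis and
    reduces the claim to the real inequality. If \<open>cinner f g = 0\<close>, then
    \<open>sgn\<close> gives \<open>c = 0\<close>, so only \<open>cmod c \<le> 1\<close> is
    available.\<close>
  define c where "c = cnj (sgn (cinner f g))"
  have "cinner (c *\<^sub>C f) g = of_real (cmod (cinner f g))"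
    unfolding c_def cinner_scaleC_left
    by (cases "cinner f g = 0")
       (auto simp: sgn_div_norm scaleR_conv_of_real complex_norm_square[symmetric]
          mult.commute[of "cnj _"] power2_eq_square mult.assoc)
  then have "cmod (cinner f g) = inner (c *\<^sub>C f) g"
    by (simp add: inner_L2_def)
  also have "\<dots> \<le> norm (c *\<^sub>C f) * norm g" by (rule norm_cauchy_schwarz)
  also have "\<dots> \<le> 1 * norm f * norm g"
    unfolding norm_scaleC by (intro mult_right_mono) (auto simp: c_def norm_sgn)
  finally show ?thesis by simp
qed

section \<open>Spectral estimates\<close>

locale spectral_resolution =
  fixes T :: L2_operator and E :: "real set \<Rightarrow> L2 \<Rightarrow> L2"
  assumes adjoint_eq: "T = adjoint T" and spectral: "spectral_measure T E"
begin

lemma mem_iff: "(f, g) \<in> T \<longleftrightarrow> (\<forall>(h, k)\<in>T. cinner k f = cinner h g)"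
proof -
  have "(f, g) \<in> T \<longleftrightarrow> (f, g) \<in> adjoint T" using adjoint_eq by (rule arg_cong)
  then show ?thesis by (simp add: adjoint_def)
qed

text \<open>Self-adjointness turns membership in the graph into a test against all graph pairs. This
  yields linearity of \<open>T\<close> and, later, invariance under the spectral projections without
  any approximation argument.\<close>

lemma memI: "(\<And>h k. (h, k) \<in> T \<Longrightarrow> cinner k f = cinner h g) \<Longrightarrow> (f, g) \<in> T"
  using mem_iff[of f g] by auto

lemma symmetric: "(f, g) \<in> T \<Longrightarrow> (h, k) \<in> T \<Longrightarrow> cinner g h = cinner f k"
  using mem_iff[of h k] by auto

lemma add: "(f, g) \<in> T \<Longrightarrow> (h, k) \<in> T \<Longrightarrow> (f + h, g + k) \<in> T"
  by (rule memI) (simp only: cinner_simps, metis symmetric)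

lemma scaleC: "(f, g) \<in> T \<Longrightarrow> (c *\<^sub>C f, c *\<^sub>C g) \<in> T"
  by (rule memI) (simp only: cinner_simps, metis symmetric)

lemma diff: "(f, g) \<in> T \<Longrightarrow> (h, k) \<in> T \<Longrightarrow> (f - h, g - k) \<in> T"
  by (rule memI) (simp only: cinner_simps, metis symmetric)

section \<open>Calculus of the spectral projections\<close>

lemma pvm: "projection_valued_measure E"
  using spectral by (simp add: spectral_measure_def)

lemma
  assumes "B \<in> sets borel"
  shows proj_add: "E B (f + g) = E B f + E B g"
    and proj_scaleC: "E B (c *\<^sub>C f) = c *\<^sub>C E B f"
    and proj_idem: "E B (E B f) = E B f"
    and proj_symmetric: "cinner (E B f) g = cinner f (E B g)"
proof -
  have "orthogonal_projection (E B)"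
    using pvm assms by (simp add: projection_valued_measure_def)
  then show "E B (f + g) = E B f + E B g" "E B (c *\<^sub>C f) = c *\<^sub>C E B f"
    "E B (E B f) = E B f" "cinner (E B f) g = cinner f (E B g)"
    unfolding orthogonal_projection_def by simp_all
qed

lemma proj_diff: "B \<in> sets borel \<Longrightarrow> E B (f - g) = E B f - E B g"
  using proj_add[of B "f - g" g] by (simp add: eq_diff_eq)

lemma proj_empty: "E {} f = 0" and proj_UNIV: "E UNIV f = f"
  using pvm by (simp_all add: projection_valued_measure_def)

lemma proj_Int: "A \<in> sets borel \<Longrightarrow> B \<in> sets borel \<Longrightarrow> E A (E B f) = E (A \<inter> B) f"
  using pvm by (simp add: projection_valued_measure_def)

lemma proj_sums:
  "range A \<subseteq> sets borel \<Longrightarrow> disjoint_family A \<Longrightarrow> (\<lambda>i. E (A i) f) sums E (\<Union>i. A i) f"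
  using pvm by (simp add: projection_valued_measure_def)

text \<open>Countable additivity applied to \<open>A\<close>, \<open>B\<close>, followed by empty
  sets, whose projections vanish.\<close>

lemma proj_Un:
  assumes "A \<in> sets borel" "B \<in> sets borel" "A \<inter> B = {}"
  shows "E (A \<union> B) f = E A f + E B f"
proof -
  have "(\<lambda>i. E (binaryset A B i) f) sums E (\<Union>i. binaryset A B i) f"
    by (rule proj_sums)
       (use assms in \<open>auto simp: range_binaryset_eq disjoint_family_on_def binaryset_def\<close>)
  moreover have "(\<lambda>i. E (binaryset A B i) f) sums (\<Sum>i\<in>{0, Suc 0}. E (binaryset A B i) f)"
    by (rule sums_finite) (auto simp: binaryset_def proj_empty)
  ultimately have "E (\<Union>i. binaryset A B i) f = (\<Sum>i\<in>{0, Suc 0}. E (binaryset A B i) f)"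
    by (rule sums_unique2)
  then show ?thesis by (simp add: UN_binaryset_eq) (simp add: binaryset_def)
qed

lemma proj_compl: "B \<in> sets borel \<Longrightarrow> E (- B) f = f - E B f"
  using proj_Un[of B "- B" f] by (simp add: proj_UNIV eq_diff_eq add.commute)

lemma proj_norm:
  assumes "B \<in> sets borel" shows "Re (cinner (E B f) f) = (norm (E B f))\<^sup>2"
  using proj_symmetric[OF assms, of "E B f" f] cinner_self_norm[of "E B f"]
  by (simp add: proj_idem[OF assms])

lemma proj_Pythagoras:
  assumes [simp]: "A \<in> sets borel" "B \<in> sets borel" and "A \<inter> B = {}"
  shows "(norm (E (A \<union> B) f))\<^sup>2 = (norm (E A f))\<^sup>2 + (norm (E B f))\<^sup>2"
  using proj_norm[OF sets.Un[OF assms(1,2)], of f] proj_norm[of A f] proj_norm[of B f]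
  by (simp add: proj_Un[OF assms] cinner_add_left)

lemma proj_norm_mono:
  assumes "A \<in> sets borel" "B \<in> sets borel" "A \<subseteq> B"
  shows "norm (E A f) \<le> norm (E B f)"
proof -
  have "(norm (E (A \<union> (B - A)) f))\<^sup>2 = (norm (E A f))\<^sup>2 + (norm (E (B - A) f))\<^sup>2"
    by (rule proj_Pythagoras) (use assms in auto)
  moreover have "A \<union> (B - A) = B" using assms by auto
  ultimately have "(norm (E A f))\<^sup>2 \<le> (norm (E B f))\<^sup>2" by simp
  then show ?thesis by (simp add: power2_le_iff_abs_le)
qed

lemma proj_norm_le: "B \<in> sets borel \<Longrightarrow> norm (E B f) \<le> norm f"
  using proj_norm_mono[of B UNIV f] by (simp add: proj_UNIV)

section \<open>Scalar spectral measures and the domain of \<open>T\<close>\<close>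

abbreviation \<mu> :: "L2 \<Rightarrow> real measure" where "\<mu> \<equiv> scalar_spectral_measure E"

lemma space_\<mu> [simp]: "space (\<mu> f) = UNIV" and sets_\<mu> [measurable_cong, simp]: "sets (\<mu> f) = sets borel"
  by (simp_all add: scalar_spectral_measure_def sets_measure_of_conv space_measure_of_conv
      sets.sigma_sets_eq[of borel, simplified])

text \<open>\<open>measure_of\<close> falls back to the zero measure unless the set function is
  countably additive. Additivity comes from pairing the strongly convergent series of projections
  with \<open>f\<close>.\<close>

lemma emeasure_\<mu>:
  assumes "B \<in> sets borel" shows "emeasure (\<mu> f) B = ennreal ((norm (E B f))\<^sup>2)"
proof -
  have "emeasure (\<mu> f) B = ennreal (Re (cinner (E B f) f))"
  proof (rule emeasure_measure_of)
    show "\<mu> f = measure_of UNIV (sets borel) (\<lambda>B. ennreal (Re (cinner (E B f) f)))"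
      by (simp add: scalar_spectral_measure_def)
    show "positive (sets (\<mu> f)) (\<lambda>B. ennreal (Re (cinner (E B f) f)))"
      by (simp add: positive_def proj_empty)
    show "countably_additive (sets (\<mu> f)) (\<lambda>B. ennreal (Re (cinner (E B f) f)))"
      unfolding countably_additive_def sets_\<mu>
    proof (intro allI impI)
      fix A :: "nat \<Rightarrow> real set"
      assume A: "range A \<subseteq> sets borel" "disjoint_family A"
      have "(\<lambda>i. inner (E (A i) f) f) sums inner (E (\<Union>i. A i) f) f"
        by (rule bounded_linear.sums[OF bounded_linear_inner_left proj_sums[OF A]])
      moreover have "0 \<le> inner (E (A i) f) f" for i
        using A proj_norm[of "A i" f] by (auto simp: inner_L2_def)
      ultimately show "(\<Sum>i. ennreal (Re (cinner (E (A i) f) f)))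
          = ennreal (Re (cinner (E (\<Union>i. A i) f) f))"
        unfolding inner_L2_def by (intro suminf_ennreal_eq)
    qed
  qed (use assms in auto)
  then show ?thesis by (simp add: proj_norm[OF assms])
qed

lemma finite_measure_\<mu>: "finite_measure (\<mu> f)"
  by (rule finite_measureI) (simp add: emeasure_\<mu>)

lemma measure_\<mu>_UNIV: "measure (\<mu> f) UNIV = (norm f)\<^sup>2"
  by (simp add: measure_def emeasure_\<mu> proj_UNIV)

text \<open>Multiplicativity of \<open>E\<close> turns projecting the vector into restricting its
  measure.\<close>

lemma \<mu>_proj:
  assumes "B \<in> sets borel" shows "\<mu> (E B f) = density (\<mu> f) (indicator B)"
proof (rule measure_eqI)
  fix A assume "A \<in> sets (\<mu> (E B f))"
  then have A: "A \<in> sets borel" by simp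
  have "emeasure (density (\<mu> f) (indicator B)) A = (\<integral>\<^sup>+x. indicator (B \<inter> A) x \<partial>\<mu> f)"
    using A assms by (simp add: emeasure_density indicator_inter_arith)
  also have "\<dots> = emeasure (\<mu> f) (B \<inter> A)" using A assms by simp
  finally show "emeasure (\<mu> (E B f)) A = emeasure (density (\<mu> f) (indicator B)) A"
    using emeasure_\<mu>[OF A, of "E B f"] emeasure_\<mu>[of "B \<inter> A" f] proj_Int[OF A assms, of f] A assms
    by (simp add: Int_commute)
qed simp

lemma domain_iff: "f \<in> Domain T \<longleftrightarrow> integrable (\<mu> f) (\<lambda>x. x\<^sup>2)"
  using spectral by (simp add: spectral_measure_def)

lemma quadratic_form: "(f, g) \<in> T \<Longrightarrow> cinner g f = of_real (LINT x|\<mu> f. x)"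
  using spectral by (auto simp: spectral_measure_def)

lemma integrable_\<mu>_proj:
  fixes h :: "real \<Rightarrow> real"
  assumes "B \<in> sets borel" "h \<in> borel_measurable borel"
  shows "integrable (\<mu> (E B f)) h \<longleftrightarrow> integrable (\<mu> f) (\<lambda>x. indicator B x *\<^sub>R h x)"
proof -
  have "\<mu> (E B f) = density (\<mu> f) (\<lambda>x. ennreal (indicator B x))"
    using \<mu>_proj[OF assms(1)] by (simp add: ennreal_indicator)
  then show ?thesis
    using assms by (simp add: integrable_density)
qed

lemma domain_proj:
  assumes "B \<in> sets borel" "f \<in> Domain T" shows "E B f \<in> Domain T"
proof -
  have "integrable (\<mu> f) (\<lambda>x. x\<^sup>2)" using assms(2) by (simp add: domain_iff)
  then have "integrable (\<mu> f) (\<lambda>x. indicator B x *\<^sub>R x\<^sup>2)"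
    by (rule integrable_mult_indicator[rotated]) (use assms in simp)
  then show ?thesis by (simp add: domain_iff integrable_\<mu>_proj[OF assms(1)])
qed

text \<open>The second moment of the restricted measure is finite, since \<open>x\<^sup>2\<close> is
  bounded on \<open>B\<close> and the total mass is finite.\<close>

lemma domain_bounded:
  assumes "B \<in> sets borel" "bounded B" shows "E B f \<in> Domain T"
proof -
  interpret finite_measure "\<mu> f" by (rule finite_measure_\<mu>)
  obtain c where c: "\<And>x. x \<in> B \<Longrightarrow> \<bar>x\<bar> \<le> c"
    using assms(2) by (auto simp: bounded_iff)
  have "norm (indicator B x *\<^sub>R x\<^sup>2) \<le> c\<^sup>2" for x :: real
    using c[of x] abs_ge_zero[of x] by (auto simp: indicator_def abs_le_square_iff[symmetric])
  then have "integrable (\<mu> f) (\<lambda>x. indicator B x *\<^sub>R x\<^sup>2)"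
    by (intro integrable_const_bound[of _ "c\<^sup>2"]) (use assms in auto)
  then show ?thesis by (simp add: domain_iff integrable_\<mu>_proj[OF assms(1)])
qed

text \<open>For orthogonal spectral components \<open>f\<close>, \<open>h\<close> the measure of \<open>f + c h\<close> does not depend on the
  phase \<open>c\<close>, so polarization of the quadratic form annihilates \<open>\<langle>T f, h\<rangle>\<close>.\<close>

lemma orthogonal_components:
  assumes B: "B \<in> sets borel" and fg: "(f, g) \<in> T" and hk: "(h, k) \<in> T"
    and f: "E B f = f" and h: "E B h = 0"
  shows "cinner g h = 0"
proof -
  have cross: "cinner (E A f) h = 0" "cinner (E A h) f = 0" if A: "A \<in> sets borel" for A
  proof -
    have "cinner (E A f) h = cinner (E B (E A f)) h"
      using A B f by (metis proj_Int Int_commute)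
    also have "\<dots> = 0" using B h by (simp add: proj_symmetric)
    finally show "cinner (E A f) h = 0" .
    then show "cinner (E A h) f = 0"
      using A by (metis proj_symmetric cinner_commute complex_cnj_zero)
  qed
  have \<mu>: "\<mu> (f + c *\<^sub>C h) = \<mu> (f + h)" if "cmod c = 1" for c
  proof (rule measure_eqI)
    fix A assume "A \<in> sets (\<mu> (f + c *\<^sub>C h))"
    then have A: "A \<in> sets borel" by simp
    \<comment> \<open>Once the cross terms have dropped out, \<open>c\<close> enters only through
      this product.\<close>
    have "cnj c * c = 1"
      using that complex_norm_square[of c] by (simp add: mult.commute)
    then have "cinner (E A (f + c *\<^sub>C h)) (f + c *\<^sub>C h) = cinner (E A (f + h)) (f + h)"
      using A by (simp add: proj_add proj_scaleC cinner_simps cross)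
    then show "emeasure (\<mu> (f + c *\<^sub>C h)) A = emeasure (\<mu> (f + h)) A"
      using A by (simp add: emeasure_\<mu> proj_norm[symmetric])
  qed simp
  have form: "cinner (g + c *\<^sub>C k) (f + c *\<^sub>C h) = of_real (LINT x|\<mu> (f + h). x)"
    if "cmod c = 1" for c
    using quadratic_form[OF add[OF fg scaleC[OF hk, of c]]] \<mu>[OF that] by simp
  \<comment> \<open>Comparing opposite phases cancels the diagonal terms. The pair \<open>1\<close>,
    \<open>- 1\<close> gives the sum of the two cross terms, the pair \<open>\<i>\<close>,
    \<open>- \<i>\<close> their difference.\<close>
  have "cinner (g + 1 *\<^sub>C k) (f + 1 *\<^sub>C h) = cinner (g + (- 1) *\<^sub>C k) (f + (- 1) *\<^sub>C h)"
    "cinner (g + \<i> *\<^sub>C k) (f + \<i> *\<^sub>C h) = cinner (g + (- \<i>) *\<^sub>C k) (f + (- \<i>) *\<^sub>C h)"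
    by (simp_all only: form norm_one norm_minus_cancel norm_ii)
  then have "cinner g h + cinner k f = 0" "\<i> * (cinner k f - cinner g h) = 0"
    by (simp_all only: cinner_simps) (simp_all add: algebra_simps)
  then show ?thesis by simp
qed

text \<open>The adjoint criterion is checked after splitting both vectors along \<open>B\<close> and
  its complement. All pieces stay in the domain, and \<open>orthogonal_components\<close> removes
  the mixed terms.\<close>

lemma proj_commute:
  assumes B: "B \<in> sets borel" and fg: "(f, g) \<in> T"
  shows "(E B f, E B g) \<in> T"
proof (rule memI)
  fix h k assume hk: "(h, k) \<in> T"
  have C: "- B \<in> sets borel" using B by simp
  have split: "(E B h', k1) \<in> T \<Longrightarrow> (E (- B) f', g2) \<in> T \<Longrightarrow> cinner k1 (E (- B) f') = 0"
    for h' f' k1 g2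
    by (rule orthogonal_components[OF B, of "E B h'" k1 "E (- B) f'" g2])
       (use B C in \<open>simp_all add: proj_Int proj_empty\<close>)
  obtain g1 g2 h1 h2 where
    g1: "(E B f, g1) \<in> T" and g2: "(E (- B) f, g2) \<in> T" and
    h1: "(E B h, h1) \<in> T" and h2: "(E (- B) h, h2) \<in> T"
    using fg hk B C domain_proj by (meson Domain.DomainI DomainE)
  have "cinner k (E B f) = cinner h g1" by (rule symmetric[OF hk g1])
  also have "\<dots> = cinner (E B h) g1 + cinner (E (- B) h) g1"
    by (simp add: proj_compl[OF B] cinner_diff_left)
  also have "cinner (E (- B) h) g1 = 0"
    using split[OF g1 h2] by (metis cinner_commute complex_cnj_zero)
  also have "cinner (E B h) g1 = cinner h1 (E B f)" by (rule symmetric[OF h1 g1, symmetric])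
  also have "\<dots> = cinner h1 (E B f) + cinner h1 (E (- B) f)"
    using split[OF h1 g2] by simp
  also have "\<dots> = cinner h1 f" by (simp add: proj_compl[OF B] cinner_diff_right)
  also have "\<dots> = cinner (E B h) g" by (rule symmetric[OF h1 fg])
  also have "\<dots> = cinner h (E B g)" by (rule proj_symmetric[OF B])
  finally show "cinner k (E B f) = cinner h (E B g)" by simp
qed

section \<open>Norm estimates from the quadratic form\<close>

lemma integrable_\<mu>_id:
  assumes "f \<in> Domain T"
  shows "integrable (\<mu> f) (\<lambda>x. x)"
proof -
  interpret finite_measure "\<mu> f" by (rule finite_measure_\<mu>)
  have "integrable (\<mu> f) (\<lambda>x. 1 + x\<^sup>2)" using assms by (simp add: domain_iff)
  then show ?thesis
  proof (rule Bochner_Integration.integrable_bound)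
    have "\<bar>x\<bar> \<le> 1 + x\<^sup>2" for x :: real
      using sum_squares_bound[of "\<bar>x\<bar>" 1] by (simp add: power2_eq_square)
    then show "AE x in \<mu> f. norm x \<le> norm (1 + x\<^sup>2)" by (simp add: abs_le_iff)
  qed simp
qed

lemma AE_\<mu>_support:
  assumes "B \<in> sets borel" "E B f = f" shows "AE x in \<mu> f. x \<in> B"
proof (rule AE_I')
  have "emeasure (\<mu> f) (- B) = 0"
    using assms by (simp add: emeasure_\<mu> proj_compl)
  then show "- B \<in> null_sets (\<mu> f)" using assms by (auto simp: null_sets_def)
qed auto

text \<open>\<open>\<mu> f\<close> is carried by \<open>B\<close> and has mass
  \<open>(norm f)\<^sup>2\<close>, so the pointwise bound can be integrated.\<close>

lemma quadratic_form_ge: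
  assumes B: "B \<in> sets borel" "E B f = f" and fg: "(f, g) \<in> T" and c: "\<And>x. x \<in> B \<Longrightarrow> c \<le> x"
  shows "c * (norm f)\<^sup>2 \<le> Re (cinner g f)"
proof -
  interpret finite_measure "\<mu> f" by (rule finite_measure_\<mu>)
  have "(LINT x|\<mu> f. c) \<le> (LINT x|\<mu> f. x)"
    by (rule integral_mono_AE)
       (use AE_\<mu>_support[OF B] fg c in \<open>auto intro: integrable_\<mu>_id elim: eventually_mono\<close>)
  then show ?thesis by (simp add: quadratic_form[OF fg] measure_\<mu>_UNIV mult.commute)
qed

lemma quadratic_form_le:
  assumes B: "B \<in> sets borel" "E B f = f" and fg: "(f, g) \<in> T" and c: "\<And>x. x \<in> B \<Longrightarrow> x \<le> c"
  shows "Re (cinner g f) \<le> c * (norm f)\<^sup>2"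
proof -
  interpret finite_measure "\<mu> f" by (rule finite_measure_\<mu>)
  have "(LINT x|\<mu> f. x) \<le> (LINT x|\<mu> f. c)"
    by (rule integral_mono_AE)
       (use AE_\<mu>_support[OF B] fg c in \<open>auto intro: integrable_\<mu>_id elim: eventually_mono\<close>)
  then show ?thesis by (simp add: quadratic_form[OF fg] measure_\<mu>_UNIV mult.commute)
qed

text \<open>The form of \<open>T - l\<close> is at least \<open>d\<close> on the spectral subspace
  to the right of the gap and at most \<open>- d\<close> on the left one. Cauchy-Schwarz bounds each
  side by the residual, and Pythagoras joins the sides without losing a constant.\<close>

lemma proj_away_le:
  assumes fg: "(f, g) \<in> T" and d: "d > 0"
  shows "d * norm (E {x. d \<le> \<bar>x - l\<bar>} f) \<le> norm (g - of_real l *\<^sub>C f)"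
proof -
  define w where "w = g - of_real l *\<^sub>C f"
  have one_side: "d * norm (E B f) \<le> norm (E B w)"
    if B: "B \<in> sets borel" and side: "(\<forall>x\<in>B. l + d \<le> x) \<or> (\<forall>x\<in>B. x \<le> l - d)" for B
  proof -
    have BT: "(E B f, E B g) \<in> T" by (rule proj_commute[OF B fg])
    have idem: "E B (E B f) = E B f" by (rule proj_idem[OF B])
    have eq: "inner (E B w) (E B f) = Re (cinner (E B g) (E B f)) - l * (norm (E B f))\<^sup>2"
      by (simp add: w_def inner_L2_def proj_diff proj_scaleC B cinner_simps cinner_self_norm)
    have "d * (norm (E B f))\<^sup>2 \<le> \<bar>inner (E B w) (E B f)\<bar>"
      using side
    proof
      assume "\<forall>x\<in>B. l + d \<le> x"
      then show ?thesis
        using quadratic_form_ge[OF B idem BT, of "l + d"] unfolding eq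
        by (simp add: algebra_simps)
    next
      assume "\<forall>x\<in>B. x \<le> l - d"
      then show ?thesis
        using quadratic_form_le[OF B idem BT, of "l - d"] unfolding eq
        by (simp add: algebra_simps)
    qed
    also have "\<dots> \<le> norm (E B w) * norm (E B f)" by (rule Cauchy_Schwarz_ineq2)
    finally have "d * norm (E B f) * norm (E B f) \<le> norm (E B w) * norm (E B f)"
      by (simp add: power2_eq_square mult.assoc)
    then show ?thesis by (cases "E B f = 0") auto
  qed
  have eq: "{x. d \<le> \<bar>x - l\<bar>} = {l + d..} \<union> {..l - d}" by auto
  have disj: "{l + d..} \<inter> {..l - d} = {}" using d by auto
  have "(d * norm (E {x. d \<le> \<bar>x - l\<bar>} f))\<^sup>2
      = (d * norm (E {l + d..} f))\<^sup>2 + (d * norm (E {..l - d} f))\<^sup>2"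
    unfolding eq using disj by (simp add: power_mult_distrib proj_Pythagoras distrib_left)
  also have "\<dots> \<le> (norm (E {l + d..} w))\<^sup>2 + (norm (E {..l - d} w))\<^sup>2"
    by (intro add_mono power_mono one_side) (use d in auto)
  also have "\<dots> = (norm (E {x. d \<le> \<bar>x - l\<bar>} w))\<^sup>2"
    unfolding eq using disj by (simp add: proj_Pythagoras)
  also have "\<dots> \<le> (norm w)\<^sup>2"
    unfolding eq by (intro power_mono proj_norm_le) auto
  finally show ?thesis
    unfolding w_def[symmetric] by (rule power2_le_imp_le) simp
qed

text \<open>Polarization turns the bound of the quadratic form of \<open>T - l\<close> on the range of \<open>E B\<close> into a
  norm bound.\<close>

lemma proj_near_le:
  assumes hg: "(h, g) \<in> T" and \<eta>: "\<eta> > 0"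
    and B: "B \<in> sets borel" "\<And>x. x \<in> B \<Longrightarrow> \<bar>x - l\<bar> \<le> \<eta>"
  shows "norm (E B (g - of_real l *\<^sub>C h)) \<le> \<eta> * norm h"
proof -
  define k where "k = E B h"
  define w where "w = E B (g - of_real l *\<^sub>C h)"
  \<comment> \<open>\<open>w\<close> lies in the range of \<open>E B\<close>; boundedness of
    \<open>B\<close> puts it into the domain, so that \<open>T\<close> can be applied to it.\<close>
  have "bounded B"
    by (rule bounded_subset[of "{l - \<eta>..l + \<eta>}"]) (use B(2) in \<open>force simp: abs_le_iff\<close>)+
  then obtain w' where ww: "(w, w') \<in> T"
    unfolding w_def using domain_bounded[OF B(1)] by blast
  have kT: "(k, w + of_real l *\<^sub>C k) \<in> T"
    using proj_commute[OF B(1) hg] by (simp add: k_def w_def proj_diff proj_scaleC B(1))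
  have fix': "E B k = k" "E B w = w" by (simp_all add: k_def w_def proj_idem B(1))
  have form: "\<bar>Re (cinner (q - of_real l *\<^sub>C f) f)\<bar> \<le> \<eta> * (norm f)\<^sup>2"
    if "(f, q) \<in> T" "E B f = f" for f q
  proof -
    have "(l - \<eta>) * (norm f)\<^sup>2 \<le> Re (cinner q f)" "Re (cinner q f) \<le> (l + \<eta>) * (norm f)\<^sup>2"
      using B(2) quadratic_form_ge[OF B(1) that(2,1), of "l - \<eta>"]
        quadratic_form_le[OF B(1) that(2,1), of "l + \<eta>"] by (force simp: abs_le_iff)+
    then show ?thesis by (simp add: cinner_simps cinner_self_norm algebra_simps abs_le_iff)
  qed
  \<comment> \<open>This weight maximizes \<open>4 * c - 2 * \<eta> * c\<^sup>2\<close>, the net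
    coefficient of \<open>(norm w)\<^sup>2\<close> in the final comparison, and so gives the
    constant \<open>\<eta>\<close>.\<close>
  define c where "c = inverse \<eta>"
  define v where "v = w' - of_real l *\<^sub>C w"
  have plus: "(k + of_real c *\<^sub>C w, (w + of_real l *\<^sub>C k) + of_real c *\<^sub>C w') \<in> T"
    by (intro add scaleC kT ww)
  have minus: "(k - of_real c *\<^sub>C w, (w + of_real l *\<^sub>C k) - of_real c *\<^sub>C w') \<in> T"
    by (intro diff scaleC kT ww)
  have fixc: "E B (c *\<^sub>R w) = c *\<^sub>R w"
    using proj_scaleC[OF B(1), of "of_real c" w] fix' by (simp add: scaleC_of_real)
  have "\<bar>inner (w + c *\<^sub>R v) (k + c *\<^sub>R w)\<bar> \<le> \<eta> * (norm (k + c *\<^sub>R w))\<^sup>2"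
    using form[OF plus] fix' fixc B(1)
    by (simp add: proj_add proj_scaleC inner_L2_def v_def scaleC_of_real algebra_simps)
  moreover have "\<bar>inner (w - c *\<^sub>R v) (k - c *\<^sub>R w)\<bar> \<le> \<eta> * (norm (k - c *\<^sub>R w))\<^sup>2"
    using form[OF minus] fix' fixc B(1)
    by (simp add: proj_diff proj_scaleC inner_L2_def v_def scaleC_of_real algebra_simps)
  ultimately have "inner (w + c *\<^sub>R v) (k + c *\<^sub>R w) - inner (w - c *\<^sub>R v) (k - c *\<^sub>R w)
      \<le> \<eta> * ((norm (k + c *\<^sub>R w))\<^sup>2 + (norm (k - c *\<^sub>R w))\<^sup>2)"
    by (simp add: distrib_left abs_le_iff)
  \<comment> \<open>Symmetry moves \<open>T - l\<close> from \<open>w\<close> to \<open>k\<close>,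
    and \<open>w\<close> is \<open>T - l\<close> applied to \<open>k\<close>.\<close>
  moreover have "inner v k = inner w w"
    using symmetric[OF ww kT] cinner_commute[of w k]
    by (simp add: v_def inner_L2_def cinner_simps)
  ultimately have "4 * c * (norm w)\<^sup>2 \<le> 2 * \<eta> * ((norm k)\<^sup>2 + c\<^sup>2 * (norm w)\<^sup>2)"
    by (simp add: power2_norm_eq_inner inner_simps inner_commute power2_eq_square[of c] algebra_simps)
  then have "(norm w)\<^sup>2 \<le> (\<eta> * norm k)\<^sup>2"
    using \<eta> unfolding c_def by (simp add: field_simps power2_eq_square)
  then have "norm w \<le> \<eta> * norm k" by (rule power2_le_imp_le) (use \<eta> in simp)
  also have "\<dots> \<le> \<eta> * norm h" using \<eta> B(1) by (simp add: k_def proj_norm_le)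
  finally show ?thesis unfolding w_def .
qed

end

section \<open>The perturbed multiplication operator\<close>

lemma square_integrable_indicator:
  assumes "square_integrable f" "B \<in> sets borel"
  shows "square_integrable (\<lambda>x. indicator B x * f x)"
proof (rule square_integrable_dominated[OF _ assms(1), of _ 1])
  show "(\<lambda>x. indicator B x * f x) \<in> borel_measurable borel"
    using square_integrable_measurable[OF assms(1)] assms(2) by measurable
qed (auto simp: indicator_def)

lemma square_integrable_mult_indicator:
  assumes "square_integrable f" "B \<in> sets borel" "\<And>x. x \<in> B \<Longrightarrow> cmod (c x) \<le> C"
    and [measurable]: "c \<in> borel_measurable borel"
  shows "square_integrable (\<lambda>x. c x * (indicator B x * f x))"
proof (rule square_integrable_dominated[OF _ assms(1), of _ "\<bar>C\<bar>"])
  show "(\<lambda>x. c x * (indicator B x * f x)) \<in> borel_measurable borel"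
    using square_integrable_measurable[OF assms(1)] assms(2) by measurable
  show "cmod (c x * (indicator B x * f x)) \<le> \<bar>C\<bar> * cmod (f x)" for x
    using assms(3)[of x] by (cases "x \<in> B") (force simp: norm_mult intro: mult_right_mono)+
qed

lemma tendsto_abs_L2:
  assumes "\<And>k. square_integrable (f k)" "square_integrable g"
    and "((\<lambda>k. LINT x|lborel. (cmod (f k x - g x))\<^sup>2) \<longlongrightarrow> 0) F"
  shows "((\<lambda>k. abs_L2 (f k)) \<longlongrightarrow> abs_L2 g) F"
proof -
  have "((\<lambda>k. (norm (abs_L2 (f k) - abs_L2 g))\<^sup>2) \<longlongrightarrow> 0) F"
    using assms by (simp add: abs_L2_diff norm_abs_L2 square_integrable_diff)
  from tendsto_real_sqrt[OF this] have "((\<lambda>k. norm (abs_L2 (f k) - abs_L2 g)) \<longlongrightarrow> 0) F"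
    by simp
  then show ?thesis by (simp add: LIM_zero_cancel tendsto_norm_zero_iff)
qed

text \<open>Dominated convergence. It serves twice: with intervals exhausting the line, for density
  of the domain, and with complements of shrinking neighbourhoods of a point, for density of a
  range.\<close>

lemma cutoff_tendsto:
  fixes A :: "nat \<Rightarrow> real set"
  assumes g: "square_integrable g" and A: "\<And>k. A k \<in> sets borel"
    and ev: "AE x in lborel. \<forall>\<^sub>F k in sequentially. x \<in> A k"
  shows "(\<lambda>k. abs_L2 (\<lambda>x. indicator (A k) x * g x)) \<longlonglongrightarrow> abs_L2 g"
proof (rule tendsto_abs_L2)
  note [measurable] = square_integrable_measurable[OF g] A
  have "(\<lambda>k. LINT x|lborel. (cmod (indicator (A k) x * g x - g x))\<^sup>2)
      \<longlonglongrightarrow> (LINT x::real|lborel. (0::real))"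
  proof (rule integral_dominated_convergence[where w = "\<lambda>x. (cmod (g x))\<^sup>2"])
    show "integrable lborel (\<lambda>x. (cmod (g x))\<^sup>2)" by (rule square_integrable_integrable[OF g])
    show "AE x in lborel. (\<lambda>k. (cmod (indicator (A k) x * g x - g x))\<^sup>2) \<longlonglongrightarrow> 0"
      using ev
    proof eventually_elim
      case (elim x)
      show ?case
        by (rule tendsto_eventually, rule eventually_mono[OF elim]) simp
    qed
    show "AE x in lborel. norm ((cmod (indicator (A k) x * g x - g x))\<^sup>2) \<le> (cmod (g x))\<^sup>2" for k
      by (auto simp: indicator_def)
  qed measurable
  then show "(\<lambda>k. LINT x|lborel. (cmod (indicator (A k) x * g x - g x))\<^sup>2) \<longlonglongrightarrow> 0" by simp
qed (use g A in \<open>auto intro: square_integrable_indicator\<close>)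

section \<open>Domain and self-adjointness of \<open>H u a\<close>\<close>

lemma mult_x_abs_L2:
  assumes "square_integrable f" "square_integrable (\<lambda>x. of_real x * f x)"
  shows "(abs_L2 f, abs_L2 (\<lambda>x. of_real x * f x)) \<in> mult_x"
  using rep_abs_L2[OF assms(1)] rep_abs_L2[OF assms(2)] unfolding mult_x_def by auto

text \<open>The maximal domain is implicit in \<open>mult_x\<close>: since \<open>G\<close> has a
  square-integrable representative, the product of \<open>x\<close> with the representative of
  \<open>F\<close> is square-integrable too.\<close>

lemma mult_xE:
  assumes "(F, G) \<in> mult_x"
  obtains f where "square_integrable f" "square_integrable (\<lambda>x. of_real x * f x)"
    "F = abs_L2 f" "G = abs_L2 (\<lambda>x. of_real x * f x)"
proof
  note f = square_integrable_rep_L2[of F] and g = square_integrable_rep_L2[of G]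
  have eq: "AE x in lborel. rep_L2 G x = of_real x * rep_L2 F x"
    using assms by (simp add: mult_x_def)
  show "square_integrable (rep_L2 F)" by (rule f)
  have m: "(\<lambda>x. of_real x * rep_L2 F x) \<in> borel_measurable borel"
    using square_integrable_measurable[OF f] by measurable
  have "integrable lborel (\<lambda>x. (cmod (of_real x * rep_L2 F x))\<^sup>2)"
    by (rule integrable_cong_AE_imp[OF square_integrable_integrable[OF g]])
       (use m eq in auto)
  then show xf: "square_integrable (\<lambda>x. of_real x * rep_L2 F x)"
    using m by (simp add: square_integrable_def)
  show "F = abs_L2 (rep_L2 F)" by (simp add: abs_rep_L2)
  show "G = abs_L2 (\<lambda>x. of_real x * rep_L2 F x)"
    using abs_L2_eqI[OF g xf eq] by (simp add: abs_rep_L2)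
qed

lemma mult_x_symmetric:
  assumes "(F, G) \<in> mult_x" "(F', G') \<in> mult_x"
  shows "cinner G F' = cinner F G'"
  using assms by (elim mult_xE) (simp add: cinner_abs_L2 mult.left_commute mult.commute)

lemma cinner_rank_one_symmetric:
  "cinner (of_real a *\<^sub>C cinner f u *\<^sub>C u) g = cinner f (of_real a *\<^sub>C cinner g u *\<^sub>C u)"
  by (simp add: cinner_scaleC_left cinner_scaleC_right cinner_commute[of u g])

lemma H_iff:
  "(F, G) \<in> H u a \<longleftrightarrow> (F, G - of_real a *\<^sub>C cinner F (abs_L2 u) *\<^sub>C abs_L2 u) \<in> mult_x"
  unfolding H_def by force

lemma closure_Domain_H: "closure (Domain (H u a)) = UNIV"
proof (intro set_eqI iffI UNIV_I)
  fix G obtain g where g: "square_integrable g" "G = abs_L2 g" by (rule L2_cases)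
  have lim: "(\<lambda>k. abs_L2 (\<lambda>x. indicator {- real k..real k} x * g x)) \<longlonglongrightarrow> G"
    unfolding g(2)
  proof (rule cutoff_tendsto[OF g(1)])
    have "\<forall>\<^sub>F k in sequentially. x \<in> {- real k..real k}" for x
      using eventually_ge_at_top[of "nat \<lceil>\<bar>x\<bar>\<rceil>"] by eventually_elim (auto simp: abs_le_iff)
    then show "AE x in lborel. \<forall>\<^sub>F k in sequentially. x \<in> {- real k..real k}" by simp
  qed simp
  have "abs_L2 (\<lambda>x. indicator {- real k..real k} x * g x) \<in> Domain (H u a)" for k
  proof -
    have "square_integrable (\<lambda>x. of_real x * (indicator {- real k..real k} x * g x))"
      by (rule square_integrable_mult_indicator[OF g(1), where C = "real k"]) auto
    from mult_x_abs_L2[OF square_integrable_indicator[OF g(1)] this]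
    show ?thesis unfolding H_def by auto
  qed
  with lim show "G \<in> closure (Domain (H u a))"
    by (intro closure_sequential[THEN iffD2] exI conjI allI)
qed

text \<open>One inclusion is symmetry. For the other, the defect \<open>r\<close> is tested against
  its own cutoff to a bounded interval, which lies in the domain. The cutoff then has norm zero, and
  countably many intervals cover the line.\<close>

lemma adjoint_H: "H u a = adjoint (H u a)"
proof (intro set_eqI iffI; clarify)
  fix F G assume FG: "(F, G) \<in> H u a"
  show "(F, G) \<in> adjoint (H u a)"
    unfolding adjoint_def
  proof clarify
    fix h k assume hk: "(h, k) \<in> H u a"
    have "cinner (k - of_real a *\<^sub>C cinner h (abs_L2 u) *\<^sub>C abs_L2 u) F
        = cinner h (G - of_real a *\<^sub>C cinner F (abs_L2 u) *\<^sub>C abs_L2 u)"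
      using FG hk unfolding H_iff by (rule mult_x_symmetric[rotated])
    then show "cinner k F = cinner h G"
      by (simp add: cinner_diff_left cinner_diff_right cinner_rank_one_symmetric)
  qed
next
  fix F G assume FG: "(F, G) \<in> adjoint (H u a)"
  define G' where "G' = G - of_real a *\<^sub>C cinner F (abs_L2 u) *\<^sub>C abs_L2 u"
  obtain f where f: "square_integrable f" "F = abs_L2 f" by (rule L2_cases)
  obtain g where g: "square_integrable g" "G' = abs_L2 g" by (rule L2_cases)
  note [measurable] = square_integrable_measurable[OF f(1)] square_integrable_measurable[OF g(1)]
  define r where "r x = of_real x * f x - g x" for x :: real
  have "AE x in lborel. x \<in> {- real k..real k} \<longrightarrow> r x = 0" for k
  proof -
    define B where "B = {- real k..real k}"
    define h where "h x = indicator B x * r x" for x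
    have B: "B \<in> sets borel" by (simp add: B_def)
    have h: "square_integrable h"
    proof -
      have "square_integrable (\<lambda>x. of_real x * (indicator B x * f x) - indicator B x * g x)"
        by (intro square_integrable_diff square_integrable_indicator g B
            square_integrable_mult_indicator[where C = "real k"] f) (auto simp: B_def)
      also have "(\<lambda>x. of_real x * (indicator B x * f x) - indicator B x * g x) = h"
        by (auto simp: h_def r_def fun_eq_iff algebra_simps)
      finally show ?thesis .
    qed
    have idem: "indicator B x * h x = h x" for x by (simp add: h_def indicator_def)
    have xh: "square_integrable (\<lambda>x. of_real x * h x)"
      using square_integrable_mult_indicator[OF h B, of "of_real" "real k"]
      by (force simp: B_def idem[unfolded B_def] abs_le_iff)
    define h' where "h' = abs_L2 (\<lambda>x. of_real x * h x)"
    have "(abs_L2 h, h' + of_real a *\<^sub>C cinner (abs_L2 h) (abs_L2 u) *\<^sub>C abs_L2 u) \<in> H u a"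
      using mult_x_abs_L2[OF h xh] unfolding H_iff h'_def by simp
    then have "cinner (h' + of_real a *\<^sub>C cinner (abs_L2 h) (abs_L2 u) *\<^sub>C abs_L2 u) F
        = cinner (abs_L2 h) G"
      using FG unfolding adjoint_def by blast
    then have "cinner h' F = cinner (abs_L2 h) G'"
      unfolding G'_def
      by (simp add: cinner_add_left cinner_diff_right cinner_rank_one_symmetric eq_diff_eq)
    then have "(LINT x|lborel. of_real x * h x * cnj (f x)) = (LINT x|lborel. h x * cnj (g x))"
      unfolding h'_def f(2) g(2) by (simp add: cinner_abs_L2 h xh f(1) g(1))
    then have "0 = (LINT x|lborel. of_real x * h x * cnj (f x) - h x * cnj (g x))"
      using square_integrable_mult_cnj[OF xh f(1)] square_integrable_mult_cnj[OF h g(1)] by simp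
    \<comment> \<open>As \<open>x\<close> is real, the integrand is \<open>h x * cnj (r x)\<close>;
      and \<open>h\<close> agrees with \<open>r\<close> on \<open>B\<close> and vanishes
      elsewhere.\<close>
    also have "\<dots> = (LINT x|lborel. of_real ((cmod (h x))\<^sup>2))"
      unfolding complex_norm_square
      by (rule Bochner_Integration.integral_cong)
         (auto simp: h_def r_def indicator_def algebra_simps)
    also have "\<dots> = of_real (LINT x|lborel. (cmod (h x))\<^sup>2)" by (rule integral_complex_of_real)
    finally have "(LINT x|lborel. (cmod (h x))\<^sup>2) = 0" by (metis of_real_eq_0_iff)
    then have "AE x in lborel. (cmod (h x))\<^sup>2 = 0"
      using square_integrable_integrable[OF h] by (subst (asm) integral_nonneg_eq_0_iff_AE) auto
    then show ?thesis by eventually_elim (auto simp: h_def B_def)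
  qed
  then have "AE x in lborel. \<forall>k::nat. x \<in> {- real k..real k} \<longrightarrow> r x = 0"
    unfolding AE_all_countable by blast
  moreover have "AE x in lborel. rep_L2 F x = f x" unfolding f(2) by (rule rep_abs_L2[OF f(1)])
  moreover have "AE x in lborel. rep_L2 G' x = g x" unfolding g(2) by (rule rep_abs_L2[OF g(1)])
  ultimately have "AE x in lborel. rep_L2 G' x = of_real x * rep_L2 F x"
  proof eventually_elim
    case (elim x)
    obtain k where "\<bar>x\<bar> \<le> real k" using real_arch_simple by blast
    then have "r x = 0" using elim(1) by (auto simp: abs_le_iff)
    then show ?case using elim by (simp add: r_def)
  qed
  then show "(F, G) \<in> H u a" unfolding H_iff G'_def[symmetric] by (simp add: mult_x_def)
qed

lemma selfadjoint_H: "selfadjoint (H u a)"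
  using closure_Domain_H adjoint_H by (simp add: selfadjoint_def)

text \<open>Using \<open>x - l\<close> in place of \<open>x\<close> exhibits the residual of
  \<open>f\<close> at \<open>l\<close> as an explicit function plus the rank-one term.\<close>

lemma H_abs_L2:
  assumes f: "square_integrable f" and xf: "square_integrable (\<lambda>x. of_real (x - l) * f x)"
  obtains G where "(abs_L2 f, G) \<in> H u a"
    "G - of_real l *\<^sub>C abs_L2 f
      = abs_L2 (\<lambda>x. of_real (x - l) * f x) + of_real a *\<^sub>C cinner (abs_L2 f) (abs_L2 u) *\<^sub>C abs_L2 u"
proof
  have xf': "square_integrable (\<lambda>x. of_real x * f x)"
    using square_integrable_add[OF xf square_integrable_scale[OF f, of "of_real l"]]
    by (simp add: algebra_simps)
  let ?K = "of_real a *\<^sub>C cinner (abs_L2 f) (abs_L2 u) *\<^sub>C abs_L2 u"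
  show "(abs_L2 f, abs_L2 (\<lambda>x. of_real x * f x) + ?K) \<in> H u a"
    using mult_x_abs_L2[OF f xf'] by (simp add: H_iff)
  have "abs_L2 (\<lambda>x. of_real x * f x) - of_real l *\<^sub>C abs_L2 f = abs_L2 (\<lambda>x. of_real (x - l) * f x)"
    by (simp add: abs_L2_scaleC abs_L2_diff f xf' square_integrable_scale algebra_simps)
  then show "abs_L2 (\<lambda>x. of_real x * f x) + ?K - of_real l *\<^sub>C abs_L2 f
      = abs_L2 (\<lambda>x. of_real (x - l) * f x) + ?K"
    by (simp add: algebra_simps)
qed

section \<open>Truncated Cauchy kernels\<close>

text \<open>For \<open>d > 0\<close> this is \<open>1 / y\<close> outside \<open>{- d..d}\<close>
  and the linear function \<open>y / d\<^sup>2\<close> inside. Linear interpolation, unlike a cutoff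
  to zero, keeps the kernel Lipschitz, so its integrals depend continuously on the spectral
  parameter.\<close>

definition cauchy_kernel :: "real \<Rightarrow> real \<Rightarrow> real" where
  "cauchy_kernel d y = y / (max \<bar>y\<bar> d)\<^sup>2"

lemma kernel_measurable [measurable]: "cauchy_kernel d \<in> borel_measurable borel"
  unfolding cauchy_kernel_def by measurable

lemma abs_kernel_le:
  assumes "d > 0" shows "\<bar>cauchy_kernel d y\<bar> \<le> 1 / d"
proof -
  define M where "M = max \<bar>y\<bar> d"
  have M: "0 < M" "d \<le> M" "\<bar>y\<bar> \<le> M" using assms by (auto simp: M_def)
  have "\<bar>cauchy_kernel d y\<bar> = \<bar>y\<bar> / M\<^sup>2" by (simp add: cauchy_kernel_def M_def)
  also have "\<dots> \<le> M / M\<^sup>2" using M by (intro divide_right_mono) auto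
  also have "\<dots> = 1 / M" by (simp add: power2_eq_square)
  also have "\<dots> \<le> 1 / d" using M assms by (intro divide_left_mono) auto
  finally show ?thesis .
qed

lemma kernel_lipschitz:
  assumes d: "d > 0"
  shows "\<bar>cauchy_kernel d y - cauchy_kernel d z\<bar> \<le> 3 / d\<^sup>2 * \<bar>y - z\<bar>"
proof -
  define M where "M = max \<bar>y\<bar> d"
  define N where "N = max \<bar>z\<bar> d"
  have MN: "d \<le> M" "d \<le> N" "0 < M" "0 < N" "\<bar>z\<bar> \<le> N" "\<bar>M - N\<bar> \<le> \<bar>y - z\<bar>"
    using d by (auto simp: M_def N_def)
  \<comment> \<open>Changing numerator and denominator one at a time leaves three terms, each at
    most \<open>\<bar>y - z\<bar> / d\<^sup>2\<close>; hence the constant 3.\<close>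
  have "cauchy_kernel d y - cauchy_kernel d z = (y - z) / M\<^sup>2 + z / N * ((N - M) * (1 / (M * N) + 1 / M\<^sup>2))"
    unfolding cauchy_kernel_def M_def[symmetric] N_def[symmetric] using MN(3,4)
    by (simp add: divide_simps) (simp add: algebra_simps power2_eq_square)
  also have "\<bar>\<dots>\<bar> \<le> \<bar>y - z\<bar> / M\<^sup>2 + \<bar>z / N\<bar> * (\<bar>N - M\<bar> * (1 / (M * N) + 1 / M\<^sup>2))"
    using MN(3,4) by (intro order_trans[OF abs_triangle_ineq] add_mono) (simp_all add: abs_mult)
  also have "\<dots> \<le> \<bar>y - z\<bar> / d\<^sup>2 + 1 * (\<bar>y - z\<bar> * (1 / d\<^sup>2 + 1 / d\<^sup>2))"
    using MN d by (intro add_mono mult_mono divide_left_mono power_mono)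
      (auto simp: power2_eq_square intro: mult_mono)
  finally show ?thesis by (simp add: field_simps)
qed

text \<open>Here \<open>y = x - l\<close> and \<open>s = l - l\<^sub>0\<close>: the kernel at \<open>l\<close>, weighted by
  \<open>(x - l\<^sub>0)\<^sup>2\<close>, is compared with its first-order expansion at \<open>l\<^sub>0\<close>.\<close>

lemma kernel_expansion:
  assumes d: "d > 0"
  shows "\<bar>(y + s)\<^sup>2 * cauchy_kernel d y - (y + s) - s\<bar>
    \<le> \<bar>s\<bar> / 4 + \<bar>s\<bar> * (s\<^sup>2 / (max \<bar>y\<bar> d)\<^sup>2) + indicator {- d..d} y * (2 * d + 4 * \<bar>s\<bar>)"
proof -
  define M where "M = max \<bar>y\<bar> d"
  have M: "M > 0" using d by (simp add: M_def)
  \<comment> \<open>This trades the remainder \<open>s\<^sup>2 / M\<close> for a term quadratic in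
    \<open>1 / M\<close>, at the price of a quarter of \<open>\<bar>s\<bar>\<close>, which remains
    below the linear term kept in the expansion.\<close>
  have "z \<le> 1 / 4 + z\<^sup>2" for z :: real
    using zero_le_power2[of "z - 1 / 2"] by (simp add: power2_diff power_divide)
  from this[of "\<bar>s\<bar> / M"] have "\<bar>s\<bar> / M \<le> 1 / 4 + s\<^sup>2 / M\<^sup>2"
    by (simp add: power_divide)
  from mult_left_mono[OF this, of "\<bar>s\<bar>"]
  have young: "s\<^sup>2 / M \<le> \<bar>s\<bar> / 4 + \<bar>s\<bar> * (s\<^sup>2 / M\<^sup>2)"
    by (simp add: algebra_simps power2_eq_square)
  have "\<bar>(y + s)\<^sup>2 * cauchy_kernel d y - (y + s) - s\<bar>
      \<le> s\<^sup>2 / M + indicator {- d..d} y * (2 * d + 4 * \<bar>s\<bar>)"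
  proof (cases "\<bar>y\<bar> \<le> d")
    case True
    then have Md: "M = d" by (simp add: M_def)
    have c: "\<bar>y / d\<bar> \<le> 1" using True d by (simp add: field_simps)
    have "(y + s)\<^sup>2 * cauchy_kernel d y - (y + s) - s
        = y * ((y / d)\<^sup>2 - 1) + 2 * s * ((y / d)\<^sup>2 - 1) + s\<^sup>2 / d * (y / d)"
      unfolding cauchy_kernel_def M_def[symmetric] Md using d
      by (simp add: divide_simps) (simp add: algebra_simps power2_eq_square)
    also have "\<bar>\<dots>\<bar> \<le> \<bar>y\<bar> * \<bar>(y / d)\<^sup>2 - 1\<bar> + 2 * \<bar>s\<bar> * \<bar>(y / d)\<^sup>2 - 1\<bar> + s\<^sup>2 / d * \<bar>y / d\<bar>"
      using d by (intro order_trans[OF abs_triangle_ineq] add_mono) (simp_all add: abs_mult)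
    also have "\<dots> \<le> d * 1 + 2 * \<bar>s\<bar> * 1 + s\<^sup>2 / d * 1"
    proof -
      have "(y / d)\<^sup>2 \<le> 1" using c by (simp add: abs_square_le_1)
      then have "\<bar>(y / d)\<^sup>2 - 1\<bar> \<le> 1" by (simp add: abs_le_iff)
      then show ?thesis using True c d by (intro add_mono mult_mono) auto
    qed
    also have "\<dots> \<le> s\<^sup>2 / d + indicator {- d..d} y * (2 * d + 4 * \<bar>s\<bar>)"
      using True d by (simp add: indicator_def abs_le_iff)
    finally show ?thesis by (simp add: Md)
  next
    case False
    then have My: "M = \<bar>y\<bar>" and y: "y \<noteq> 0" using d by (auto simp: M_def)
    have "(y + s)\<^sup>2 * cauchy_kernel d y - (y + s) - s = s\<^sup>2 / y"
      unfolding cauchy_kernel_def M_def[symmetric] My using y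
      by (simp add: divide_simps) (simp add: algebra_simps power2_eq_square)
    then show ?thesis using d by (simp add: My)
  qed
  with young show ?thesis by (simp add: M_def)
qed

text \<open>With \<open>y = x - l\<close> and \<open>s = l - l\<^sub>0\<close>, the left side is the
  squared relative error of the trial function against the eigenfunction. The error is
  \<open>s / y\<close> outside the truncation; inside, it is a bounded part plus one of size at most
  \<open>\<bar>s\<bar> / d\<close>.\<close>

lemma kernel_difference_quotient:
  assumes d: "d > 0"
  shows "((y + s) * cauchy_kernel d y - 1)\<^sup>2 \<le> 2 * (s\<^sup>2 / (max \<bar>y\<bar> d)\<^sup>2) + 2 * indicator {- d..d} y"
proof (cases "\<bar>y\<bar> \<le> d")
  case True
  then have Md: "max \<bar>y\<bar> d = d" by simp
  have c: "\<bar>y / d\<bar> \<le> 1" using True d by (simp add: field_simps)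
  have "(y / d)\<^sup>2 \<le> 1" using c by (simp add: abs_square_le_1)
  then have 1: "((y / d)\<^sup>2 - 1)\<^sup>2 \<le> 1"
    by (simp add: abs_square_le_1 abs_le_iff)
  have 2: "(s / d * (y / d))\<^sup>2 \<le> (s / d)\<^sup>2 * 1"
    unfolding power_mult_distrib using \<open>(y / d)\<^sup>2 \<le> 1\<close> by (intro mult_left_mono) auto
  have "(y + s) * cauchy_kernel d y - 1 = ((y / d)\<^sup>2 - 1) + s / d * (y / d)"
    unfolding cauchy_kernel_def Md using d
    by (simp add: divide_simps) (simp add: algebra_simps power2_eq_square)
  also have "\<dots>\<^sup>2 \<le> 2 * ((y / d)\<^sup>2 - 1)\<^sup>2 + 2 * (s / d * (y / d))\<^sup>2"
    using sum_squares_bound[of "(y / d)\<^sup>2 - 1" "s / d * (y / d)"] by (simp add: power2_sum)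
  also have "\<dots> \<le> 2 * 1 + 2 * ((s / d)\<^sup>2 * 1)"
    using 1 2 by (intro add_mono mult_left_mono) auto
  finally show ?thesis using True by (simp add: Md power_divide abs_le_iff)
next
  case False
  then have My: "max \<bar>y\<bar> d = \<bar>y\<bar>" and y: "y \<noteq> 0" using d by auto
  have "(y + s) * cauchy_kernel d y - 1 = s / y"
    unfolding cauchy_kernel_def My using y by (simp add: divide_simps) (simp add: algebra_simps power2_eq_square)
  then have "((y + s) * cauchy_kernel d y - 1)\<^sup>2 = s\<^sup>2 / y\<^sup>2" by (simp add: power_divide)
  also have "\<dots> \<le> 2 * (s\<^sup>2 / y\<^sup>2) + 2 * indicator {- d..d} y"
  proof -
    have "0 \<le> s\<^sup>2 / y\<^sup>2" "0 \<le> (indicator {- d..d} y :: real)" by simp_all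
    then show ?thesis by linarith
  qed
  finally show ?thesis by (simp add: My)
qed

lemma integrable_indicator_Icc [simp]: "integrable lborel (indicator {a..b} :: real \<Rightarrow> real)"
  by (rule integrable_real_indicator) (auto simp: emeasure_lborel_Icc_eq)

text \<open>The antiderivative \<open>arctan ((x - l) / d)\<close> varies by less than
  \<open>pi\<close>, so the bound is uniform in \<open>d\<close> and \<open>t\<close>.\<close>

lemma
  assumes d: "d > 0"
  shows integrable_Poisson: "integrable lborel (\<lambda>x. d / (d\<^sup>2 + (x - l)\<^sup>2) * indicator {l - t..l + t} x)"
    and integral_Poisson_le: "(LINT x|lborel. d / (d\<^sup>2 + (x - l)\<^sup>2) * indicator {l - t..l + t} x) \<le> pi"
proof -
  have ne: "d\<^sup>2 + (x - l)\<^sup>2 \<noteq> 0" for x using d by (smt (verit) zero_le_power2 zero_less_power)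
  have "integrable lborel (\<lambda>x. d / (d\<^sup>2 + (x - l)\<^sup>2) * indicator {l - t..l + t} x) \<and>
    (LINT x|lborel. d / (d\<^sup>2 + (x - l)\<^sup>2) * indicator {l - t..l + t} x) \<le> pi"
  proof (cases "t \<ge> 0")
    case True
    have "has_bochner_integral lborel (\<lambda>x. d / (d\<^sup>2 + (x - l)\<^sup>2) * indicator {l - t..l + t} x)
        (arctan ((l + t - l) / d) - arctan ((l - t - l) / d))"
    proof (rule has_bochner_integral_FTC_Icc_real)
      show "DERIV (\<lambda>x. arctan ((x - l) / d)) x :> d / (d\<^sup>2 + (x - l)\<^sup>2)" for x
        using d ne[of x] by (auto intro!: derivative_eq_intros simp: divide_simps power2_eq_square)
      show "isCont (\<lambda>x. d / (d\<^sup>2 + (x - l)\<^sup>2)) x" for x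
        using ne by (intro continuous_intros) auto
    qed (use True in simp)
    moreover have "arctan ((l + t - l) / d) - arctan ((l - t - l) / d) \<le> pi"
      using arctan_bounded[of "(l + t - l) / d"] arctan_bounded[of "(l - t - l) / d"] by simp
    ultimately show ?thesis by (simp add: has_bochner_integral_iff)
  qed (simp add: less_imp_le)
  then show "integrable lborel (\<lambda>x. d / (d\<^sup>2 + (x - l)\<^sup>2) * indicator {l - t..l + t} x)"
    "(LINT x|lborel. d / (d\<^sup>2 + (x - l)\<^sup>2) * indicator {l - t..l + t} x) \<le> pi" by auto
qed

section \<open>Approximate eigenvectors\<close>

text \<open>\<open>Suc k\<close> stands for the order of the zero. \<open>order_bound\<close>
  provides smallness near \<open>l\<^sub>0\<close>, while \<open>linear_bound\<close> bounds the
  quotient \<open>u x / (x - l\<^sub>0)\<close> uniformly on the line.\<close>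

locale vanishing_vector =
  fixes u :: "real \<Rightarrow> complex" and l\<^sub>0 K V :: real and k :: nat
  assumes u: "square_integrable u" and KV: "0 \<le> K" "0 \<le> V"
    and order_bound: "cmod (u x) \<le> K * \<bar>x - l\<^sub>0\<bar> ^ Suc k"
    and linear_bound: "cmod (u x) \<le> V * \<bar>x - l\<^sub>0\<bar>"
begin

definition f\<^sub>0 :: "real \<Rightarrow> complex" where "f\<^sub>0 x = u x / of_real (x - l\<^sub>0)"

abbreviation v :: "real \<Rightarrow> real" where "v x \<equiv> (cmod (f\<^sub>0 x))\<^sup>2"

definition m :: real where "m = (LINT x|lborel. v x)"

lemma u_measurable [measurable]: "u \<in> borel_measurable borel"
  by (rule square_integrable_measurable[OF u])

lemma f\<^sub>0_measurable [measurable]: "f\<^sub>0 \<in> borel_measurable borel"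
  unfolding f\<^sub>0_def by measurable

text \<open>At \<open>x = l\<^sub>0\<close> the quotient takes the default value 0;
  \<open>linear_bound\<close> forces \<open>u l\<^sub>0 = 0\<close>, so the identity survives
  there.\<close>

lemma u_eq: "u x = of_real (x - l\<^sub>0) * f\<^sub>0 x"
  using linear_bound[of l\<^sub>0] by (cases "x = l\<^sub>0") (auto simp: f\<^sub>0_def)

lemma u_norm_eq: "(cmod (u x))\<^sup>2 = (x - l\<^sub>0)\<^sup>2 * v x"
  by (simp add: u_eq norm_mult power_mult_distrib del: of_real_diff)

lemma v_le: "v x \<le> V\<^sup>2"
proof -
  have "cmod (f\<^sub>0 x) \<le> V"
    using linear_bound[of x] KV
    by (cases "x = l\<^sub>0") (auto simp: f\<^sub>0_def norm_divide field_simps simp del: of_real_diff)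
  then show ?thesis by (intro power_mono) auto
qed

lemma v_le_order: "v x \<le> K\<^sup>2 * \<bar>x - l\<^sub>0\<bar> ^ (2 * k)"
proof -
  have "cmod (f\<^sub>0 x) \<le> K * \<bar>x - l\<^sub>0\<bar> ^ k"
    using order_bound[of x] KV
    by (cases "x = l\<^sub>0") (auto simp: f\<^sub>0_def norm_divide field_simps simp del: of_real_diff)
  then have "v x \<le> (K * \<bar>x - l\<^sub>0\<bar> ^ k)\<^sup>2" by (intro power_mono) auto
  then show ?thesis by (simp only: power_mult_distrib power_mult[symmetric] mult.commute[of k])
qed

lemma f\<^sub>0: "square_integrable f\<^sub>0"
proof (rule square_integrable_bound)
  show "integrable lborel (\<lambda>x. V\<^sup>2 * indicator {l\<^sub>0 - 1..l\<^sub>0 + 1} x + (cmod (u x))\<^sup>2)"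
    by (intro Bochner_Integration.integrable_add Bochner_Integration.integrable_mult_right
        square_integrable_integrable[OF u]) simp
  show "v x \<le> V\<^sup>2 * indicator {l\<^sub>0 - 1..l\<^sub>0 + 1} x + (cmod (u x))\<^sup>2" for x
  proof (cases "x \<in> {l\<^sub>0 - 1..l\<^sub>0 + 1}")
    case True
    then show ?thesis using v_le[of x] by (simp add: add_increasing2)
  next
    case False
    then have "1 \<le> \<bar>x - l\<^sub>0\<bar>" by auto
    then have "1 \<le> (x - l\<^sub>0)\<^sup>2" using one_le_power[of "\<bar>x - l\<^sub>0\<bar>" 2] by simp
    then have "1 * v x \<le> (x - l\<^sub>0)\<^sup>2 * v x" by (intro mult_right_mono) auto
    then show ?thesis using False by (simp add: u_norm_eq)
  qed
qed simp

lemma v: "integrable lborel v"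
  by (rule square_integrable_integrable[OF f\<^sub>0])

lemma v_moment: "integrable lborel (\<lambda>x. (x - l\<^sub>0) * v x)"
proof (rule Bochner_Integration.integrable_bound)
  show "integrable lborel (\<lambda>x. v x + (cmod (u x))\<^sup>2)"
    by (intro Bochner_Integration.integrable_add v square_integrable_integrable[OF u])
  have "\<bar>x - l\<^sub>0\<bar> * v x \<le> (1 + (x - l\<^sub>0)\<^sup>2) * v x" for x
  proof (rule mult_right_mono)
    have "0 \<le> (1 - \<bar>x - l\<^sub>0\<bar>)\<^sup>2" by simp
    then have "2 * \<bar>x - l\<^sub>0\<bar> \<le> 1 + (x - l\<^sub>0)\<^sup>2" by (simp add: power2_diff)
    then show "\<bar>x - l\<^sub>0\<bar> \<le> 1 + (x - l\<^sub>0)\<^sup>2" by (rule order_trans[rotated]) simp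
  qed simp
  then show "AE x in lborel. norm ((x - l\<^sub>0) * v x) \<le> norm (v x + (cmod (u x))\<^sup>2)"
    by (simp add: u_norm_eq abs_mult distrib_right)
qed simp

section \<open>Truncated Cauchy integrals near the eigenvalue\<close>

definition \<Gamma>\<^sub>0 :: real where "\<Gamma>\<^sub>0 = (LINT x|lborel. (x - l\<^sub>0) * v x)"

text \<open>Regularized Cauchy transform of the density \<open>(cmod (u x))\<^sup>2\<close>. At
  \<open>l\<^sub>0\<close> the zero of \<open>u\<close> makes the integral converge absolutely
  without truncation, with value \<open>\<Gamma>\<^sub>0\<close>. Roots of
  \<open>1 + a * \<Gamma> d l\<close> play the part of eigenvalues.\<close>

definition \<Gamma> :: "real \<Rightarrow> real \<Rightarrow> real" where
  "\<Gamma> d l = (LINT x|lborel. (cmod (u x))\<^sup>2 * cauchy_kernel d (x - l))"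

text \<open>Common error density, both for the expansion of \<open>\<Gamma>\<close> in
  \<open>l\<close> and for the distance of the trial function from \<open>f\<^sub>0\<close>.\<close>

definition q :: "real \<Rightarrow> real \<Rightarrow> real \<Rightarrow> real" where
  "q d l x = (l - l\<^sub>0)\<^sup>2 / (max \<bar>x - l\<bar> d)\<^sup>2 * v x"

lemma integrable_kernel:
  assumes "d > 0" shows "integrable lborel (\<lambda>x. (cmod (u x))\<^sup>2 * cauchy_kernel d (x - l))"
proof (rule Bochner_Integration.integrable_bound)
  show "integrable lborel (\<lambda>x. (1 / d) * (cmod (u x))\<^sup>2)"
    by (intro Bochner_Integration.integrable_mult_right square_integrable_integrable[OF u])
  show "AE x in lborel. norm ((cmod (u x))\<^sup>2 * cauchy_kernel d (x - l)) \<le> norm ((1 / d) * (cmod (u x))\<^sup>2)"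
    using mult_right_mono[OF abs_kernel_le[OF assms], of "(cmod (u _))\<^sup>2"] assms
    by (simp add: abs_mult mult.commute)
qed simp

lemma \<Gamma>_continuous:
  assumes d: "d > 0" shows "continuous_on UNIV (\<Gamma> d)"
proof (rule lipschitz_on_continuous_on, rule lipschitz_onI)
  show "0 \<le> 3 / d\<^sup>2 * (LINT x|lborel. (cmod (u x))\<^sup>2)" by simp
  fix l l'
  have "\<bar>\<Gamma> d l - \<Gamma> d l'\<bar>
      = \<bar>LINT x|lborel. (cmod (u x))\<^sup>2 * cauchy_kernel d (x - l) - (cmod (u x))\<^sup>2 * cauchy_kernel d (x - l')\<bar>"
    unfolding \<Gamma>_def using integrable_kernel[OF d] by simp
  also have "\<dots> \<le> (LINT x|lborel. (3 / d\<^sup>2 * \<bar>l - l'\<bar>) * (cmod (u x))\<^sup>2)"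
  proof (rule order_trans[OF integral_abs_bound], rule integral_mono)
    show "integrable lborel (\<lambda>x. (3 / d\<^sup>2 * \<bar>l - l'\<bar>) * (cmod (u x))\<^sup>2)"
      by (intro Bochner_Integration.integrable_mult_right square_integrable_integrable[OF u])
    fix x
    have "\<bar>(cmod (u x))\<^sup>2 * cauchy_kernel d (x - l) - (cmod (u x))\<^sup>2 * cauchy_kernel d (x - l')\<bar>
        = \<bar>cauchy_kernel d (x - l) - cauchy_kernel d (x - l')\<bar> * (cmod (u x))\<^sup>2"
      unfolding right_diff_distrib[symmetric] abs_mult by simp
    also have "\<dots> \<le> (3 / d\<^sup>2 * \<bar>(x - l) - (x - l')\<bar>) * (cmod (u x))\<^sup>2"
      by (intro mult_right_mono kernel_lipschitz d) simp
    finally show "\<bar>(cmod (u x))\<^sup>2 * cauchy_kernel d (x - l) - (cmod (u x))\<^sup>2 * cauchy_kernel d (x - l')\<bar>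
        \<le> (3 / d\<^sup>2 * \<bar>l - l'\<bar>) * (cmod (u x))\<^sup>2" by (simp add: abs_minus_commute)
  qed (use integrable_kernel[OF d] in simp)
  finally show "dist (\<Gamma> d l) (\<Gamma> d l') \<le> 3 / d\<^sup>2 * (LINT x|lborel. (cmod (u x))\<^sup>2) * dist l l'"
    by (simp add: dist_real_def mult_ac)
qed

lemma q_integrable:
  assumes d: "d > 0" shows "integrable lborel (q d l)"
proof (rule Bochner_Integration.integrable_bound)
  show "integrable lborel (\<lambda>x. (l - l\<^sub>0)\<^sup>2 / d\<^sup>2 * v x)"
    by (intro Bochner_Integration.integrable_mult_right v)
  show "q d l \<in> borel_measurable lborel" unfolding q_def by measurable
  have "(l - l\<^sub>0)\<^sup>2 / (max \<bar>x - l\<bar> d)\<^sup>2 * v x \<le> (l - l\<^sub>0)\<^sup>2 / d\<^sup>2 * v x" for x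
    using d by (intro mult_right_mono divide_left_mono power_mono) auto
  then show "AE x in lborel. norm (q d l x) \<le> norm ((l - l\<^sub>0)\<^sup>2 / d\<^sup>2 * v x)"
    unfolding q_def by simp
qed

text \<open>The summands bound the integral of \<open>q\<close> over
  \<open>\<bar>x - l\<bar> \<le> t\<close> by the order of the zero, over the shell out to radius
  \<open>\<rho>\<close> by boundedness of \<open>v\<close>, and beyond \<open>\<rho>\<close> by the
  mass \<open>m\<close>.\<close>

definition R :: "real \<Rightarrow> real \<Rightarrow> real \<Rightarrow> real" where
  "R t d \<rho> = 2 * pi * (K\<^sup>2 * (2 * t) ^ (2 * k) * t\<^sup>2 / d) + 2 * \<rho> * V\<^sup>2 + t\<^sup>2 / \<rho>\<^sup>2 * m"

lemma q_integral_le: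
  assumes d: "0 < d" and l: "\<bar>l - l\<^sub>0\<bar> \<le> t" and \<rho>: "0 < \<rho>"
  shows "(LINT x|lborel. q d l x) \<le> R t d \<rho>"
proof -
  have t: "0 \<le> t" using l by linarith
  have tsq: "(l - l\<^sub>0)\<^sup>2 \<le> t\<^sup>2" using power_mono[OF l, of 2] by simp
  \<comment> \<open>The factor 2 comes from comparing \<open>1 / M\<^sup>2\<close> with the Poisson
    kernel, through \<open>d\<^sup>2 + (x - l)\<^sup>2 \<le> 2 * M\<^sup>2\<close>.\<close>
  define c where "c = 2 * (K\<^sup>2 * (2 * t) ^ (2 * k) * t\<^sup>2) / d"
  define P where "P x = d / (d\<^sup>2 + (x - l)\<^sup>2) * indicator {l - t..l + t} x" for x
  have P: "integrable lborel P" "integral\<^sup>L lborel P \<le> pi"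
    using integrable_Poisson[OF d] integral_Poisson_le[OF d] unfolding P_def by auto
  have c: "c \<ge> 0" using d t by (simp add: c_def)
  have Pnn: "P x \<ge> 0" for x using d by (simp add: P_def)
  have bound: "q d l x \<le> c * P x + V\<^sup>2 * indicator {l - \<rho>..l + \<rho>} x + t\<^sup>2 / \<rho>\<^sup>2 * v x" for x
  proof -
    define M where "M = max \<bar>x - l\<bar> d"
    have M: "M > 0" "\<bar>x - l\<bar> \<le> M" using d by (auto simp: M_def)
    \<comment> \<open>\<open>t\<close> and \<open>\<rho>\<close> are not ordered; for
      \<open>\<rho> \<le> t\<close> the middle zone is empty.\<close>
    consider "\<bar>x - l\<bar> \<le> t" | "t < \<bar>x - l\<bar>" "\<bar>x - l\<bar> \<le> \<rho>" | "\<rho> < \<bar>x - l\<bar>" by linarith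
    then show ?thesis
    proof cases
      case 1
      have "v x \<le> K\<^sup>2 * \<bar>x - l\<^sub>0\<bar> ^ (2 * k)" by (rule v_le_order)
      also have "\<dots> \<le> K\<^sup>2 * (2 * t) ^ (2 * k)"
        using 1 l by (intro mult_left_mono power_mono) auto
      finally have vx: "v x \<le> K\<^sup>2 * (2 * t) ^ (2 * k)" .
      have "(x - l)\<^sup>2 \<le> M\<^sup>2" using M by (simp add: abs_le_square_iff[symmetric])
      moreover have "d\<^sup>2 \<le> M\<^sup>2" using d by (intro power_mono) (auto simp: M_def)
      ultimately have "d\<^sup>2 + (x - l)\<^sup>2 \<le> 2 * M\<^sup>2" by linarith
      moreover have pos: "0 < d\<^sup>2 + (x - l)\<^sup>2" using d by (simp add: add_pos_nonneg)
      ultimately have "1 / M\<^sup>2 \<le> 2 / (d\<^sup>2 + (x - l)\<^sup>2)" using M by (simp add: field_simps)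
      then have "(l - l\<^sub>0)\<^sup>2 * (1 / M\<^sup>2) * v x
          \<le> t\<^sup>2 * (2 / (d\<^sup>2 + (x - l)\<^sup>2)) * (K\<^sup>2 * (2 * t) ^ (2 * k))"
        using vx tsq pos by (intro mult_mono) auto
      also have "\<dots> = c * P x"
        using 1 d by (simp add: P_def c_def indicator_def abs_le_iff)
      finally have "q d l x \<le> c * P x" by (simp add: q_def M_def)
      moreover have "0 \<le> V\<^sup>2 * indicator {l - \<rho>..l + \<rho>} x + t\<^sup>2 / \<rho>\<^sup>2 * v x" by simp
      ultimately show ?thesis by linarith
    next
      case 2
      have "(l - l\<^sub>0)\<^sup>2 \<le> M\<^sup>2" using 2 l M(2) by (simp add: abs_le_square_iff[symmetric])
      then have "(l - l\<^sub>0)\<^sup>2 / M\<^sup>2 * v x \<le> 1 * V\<^sup>2"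
        using M by (intro mult_mono v_le) auto
      then have "q d l x \<le> V\<^sup>2 * indicator {l - \<rho>..l + \<rho>} x"
        using 2 by (simp add: q_def M_def indicator_def abs_le_iff)
      moreover have "0 \<le> c * P x" "0 \<le> t\<^sup>2 / \<rho>\<^sup>2 * v x" using c Pnn by auto
      ultimately show ?thesis by linarith
    next
      case 3
      have "(l - l\<^sub>0)\<^sup>2 / M\<^sup>2 * v x \<le> t\<^sup>2 / \<rho>\<^sup>2 * v x"
        using 3 M \<rho> by (intro mult_right_mono frac_le tsq power_mono[of \<rho> M]) auto
      then have "q d l x \<le> t\<^sup>2 / \<rho>\<^sup>2 * v x" by (simp add: q_def M_def)
      moreover have "0 \<le> c * P x" "0 \<le> V\<^sup>2 * indicator {l - \<rho>..l + \<rho>} x" using c Pnn by auto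
      ultimately show ?thesis by linarith
    qed
  qed
  have "(LINT x|lborel. q d l x)
      \<le> (LINT x|lborel. c * P x + V\<^sup>2 * indicator {l - \<rho>..l + \<rho>} x + t\<^sup>2 / \<rho>\<^sup>2 * v x)"
    by (rule integral_mono[OF q_integrable[OF d] _ bound])
       (intro Bochner_Integration.integrable_add Bochner_Integration.integrable_mult_right P v
          integrable_indicator_Icc)
  also have "\<dots> = c * integral\<^sup>L lborel P + V\<^sup>2 * (2 * \<rho>) + t\<^sup>2 / \<rho>\<^sup>2 * m"
    using P v \<rho> by (simp add: m_def)
  also have "\<dots> \<le> c * pi + V\<^sup>2 * (2 * \<rho>) + t\<^sup>2 / \<rho>\<^sup>2 * m"
    using P(2) c by (intro add_right_mono mult_left_mono) auto
  finally show ?thesis by (simp add: R_def c_def mult_ac)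
qed

text \<open>\<open>\<Gamma> d\<close> is nearly affine around \<open>l\<^sub>0\<close> with slope
  \<open>m\<close>. The error is \<open>kernel_expansion\<close> weighted by \<open>v\<close>: the
  quarter of \<open>\<bar>s\<bar>\<close> gives \<open>m / 4\<close>, the quadratic term gives
  \<open>q\<close>, and the indicator lives on an interval of length \<open>2 * d\<close>.\<close>

lemma \<Gamma>_expansion:
  assumes d: "0 < d" and l: "\<bar>l - l\<^sub>0\<bar> \<le> t" and \<rho>: "0 < \<rho>"
  shows "\<bar>\<Gamma> d l - \<Gamma>\<^sub>0 - (l - l\<^sub>0) * m\<bar> \<le> t * (m / 4 + R t d \<rho>) + 2 * d * V\<^sup>2 * (2 * d + 4 * t)"
proof -
  define s where "s = l - l\<^sub>0"
  have s: "\<bar>s\<bar> \<le> t" using l by (simp add: s_def)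
  define B where "B x = \<bar>s\<bar> / 4 * v x + \<bar>s\<bar> * q d l x + V\<^sup>2 * (2 * d + 4 * \<bar>s\<bar>) * indicator {l - d..l + d} x"
    for x
  have B: "integrable lborel B"
    unfolding B_def by (intro Bochner_Integration.integrable_add
        Bochner_Integration.integrable_mult_right q_integrable d v integrable_indicator_Icc)
  have "\<bar>\<Gamma> d l - \<Gamma>\<^sub>0 - s * m\<bar>
      = \<bar>LINT x|lborel. (cmod (u x))\<^sup>2 * cauchy_kernel d (x - l) - (x - l\<^sub>0) * v x - s * v x\<bar>"
    unfolding \<Gamma>_def \<Gamma>\<^sub>0_def m_def using integrable_kernel[OF d] v_moment v by simp
  also have "\<dots> \<le> (LINT x|lborel. B x)"
  proof (rule order_trans[OF integral_abs_bound], rule integral_mono[OF _ B])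
    show "integrable lborel
        (\<lambda>x. \<bar>(cmod (u x))\<^sup>2 * cauchy_kernel d (x - l) - (x - l\<^sub>0) * v x - s * v x\<bar>)"
      using integrable_kernel[OF d] v_moment v by simp
    fix x
    have xs: "x - l\<^sub>0 = (x - l) + s" by (simp add: s_def)
    have regroup: "y\<^sup>2 * w * c - y * w - s * w = (y\<^sup>2 * c - y - s) * w" for y w c :: real
      by (simp add: algebra_simps)
    have "(cmod (u x))\<^sup>2 * cauchy_kernel d (x - l) - (x - l\<^sub>0) * v x - s * v x
        = (((x - l) + s)\<^sup>2 * cauchy_kernel d (x - l) - ((x - l) + s) - s) * v x"
      unfolding u_norm_eq xs by (rule regroup)
    then have "\<bar>(cmod (u x))\<^sup>2 * cauchy_kernel d (x - l) - (x - l\<^sub>0) * v x - s * v x\<bar>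
        = \<bar>((x - l) + s)\<^sup>2 * cauchy_kernel d (x - l) - ((x - l) + s) - s\<bar> * v x"
      by (simp only: abs_mult abs_power2 abs_norm_cancel)
    also have "\<dots> \<le> (\<bar>s\<bar> / 4 + \<bar>s\<bar> * (s\<^sup>2 / (max \<bar>x - l\<bar> d)\<^sup>2)
        + indicator {- d..d} (x - l) * (2 * d + 4 * \<bar>s\<bar>)) * v x"
      by (intro mult_right_mono kernel_expansion d) simp
    also have "\<dots> = \<bar>s\<bar> / 4 * v x + \<bar>s\<bar> * q d l x
        + indicator {- d..d} (x - l) * (2 * d + 4 * \<bar>s\<bar>) * v x"
      by (simp add: q_def s_def[symmetric] algebra_simps)
    also have "\<dots> \<le> \<bar>s\<bar> / 4 * v x + \<bar>s\<bar> * q d l x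
        + indicator {- d..d} (x - l) * (2 * d + 4 * \<bar>s\<bar>) * V\<^sup>2"
      using d by (intro add_left_mono mult_left_mono v_le) auto
    also have "\<dots> = B x" by (auto simp: B_def indicator_def)
    finally show "\<bar>(cmod (u x))\<^sup>2 * cauchy_kernel d (x - l) - (x - l\<^sub>0) * v x - s * v x\<bar> \<le> B x" .
  qed
  also have "\<dots> = \<bar>s\<bar> / 4 * m + \<bar>s\<bar> * (LINT x|lborel. q d l x) + V\<^sup>2 * (2 * d + 4 * \<bar>s\<bar>) * (2 * d)"
    unfolding B_def m_def using q_integrable[OF d] v d by simp
  also have "\<dots> \<le> t / 4 * m + t * R t d \<rho> + V\<^sup>2 * (2 * d + 4 * t) * (2 * d)"
  proof -
    have "0 \<le> (LINT x|lborel. q d l x)" by (intro integral_nonneg_AE) (simp add: q_def)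
    moreover have "0 \<le> m" by (simp add: m_def)
    ultimately show ?thesis
      using s d q_integral_le[OF d l \<rho>] by (intro add_mono mult_mono) auto
  qed
  finally show ?thesis by (simp add: s_def algebra_simps)
qed

text \<open>From \<open>l\<^sub>0\<close> to \<open>l\<^sub>0 - t\<close> or
  \<open>l\<^sub>0 + t\<close> the affine part changes by \<open>m * t\<close>. The expansion error
  uses at most half of this and the shift of the target \<open>- (1 / a)\<close> at most the other
  half, so the target is bracketed.\<close>

lemma ex_root:
  assumes a: "a \<noteq> 0" "a\<^sub>0 \<noteq> 0" and a0: "a\<^sub>0 * \<Gamma>\<^sub>0 = -1" and d: "0 < d" "d \<le> t" and \<rho>: "0 < \<rho>"
    and close: "\<bar>1 / a - 1 / a\<^sub>0\<bar> \<le> m * t / 2"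
    and small: "R t d \<rho> + 12 * V\<^sup>2 * d \<le> m / 4"
  shows "\<exists>l. \<bar>l - l\<^sub>0\<bar> \<le> t \<and> a * \<Gamma> d l = -1"
proof -
  have t: "0 < t" using d by linarith
  have \<Gamma>\<^sub>0: "\<Gamma>\<^sub>0 = - (1 / a\<^sub>0)" using a0 a(2) by (simp add: field_simps)
  \<comment> \<open>Enlarging \<open>2 * d\<close> to \<open>2 * t\<close> makes \<open>t\<close> a
    common factor and produces the 12 in \<open>small\<close>.\<close>
  have "t * (m / 4 + R t d \<rho>) + 2 * d * V\<^sup>2 * (2 * d + 4 * t)
      \<le> t * (m / 4 + R t d \<rho>) + 2 * d * V\<^sup>2 * (2 * t + 4 * t)"
    using d by (intro add_left_mono mult_left_mono add_right_mono) auto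
  also have "\<dots> = t * (m / 4 + (R t d \<rho> + 12 * V\<^sup>2 * d))" by (simp add: algebra_simps)
  also have "\<dots> \<le> t * (m / 4 + m / 4)" using small t by (intro mult_left_mono) auto
  finally have err: "t * (m / 4 + R t d \<rho>) + 2 * d * V\<^sup>2 * (2 * d + 4 * t) \<le> m * t / 2"
    by (simp add: algebra_simps)
  have "\<exists>l\<ge>l\<^sub>0 - t. l \<le> l\<^sub>0 + t \<and> \<Gamma> d l = - (1 / a)"
  proof (rule IVT')
    have "\<bar>\<Gamma> d (l\<^sub>0 - t) - \<Gamma>\<^sub>0 - (l\<^sub>0 - t - l\<^sub>0) * m\<bar> \<le> m * t / 2"
      by (rule order_trans[OF \<Gamma>_expansion[OF d(1) _ \<rho>] err]) (use t in simp)
    from abs_le_D1[OF this] have "\<Gamma> d (l\<^sub>0 - t) - \<Gamma>\<^sub>0 + m * t \<le> m * t / 2"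
      by (simp add: algebra_simps)
    then show "\<Gamma> d (l\<^sub>0 - t) \<le> - (1 / a)" using close \<Gamma>\<^sub>0 by linarith
    have "\<bar>\<Gamma> d (l\<^sub>0 + t) - \<Gamma>\<^sub>0 - (l\<^sub>0 + t - l\<^sub>0) * m\<bar> \<le> m * t / 2"
      by (rule order_trans[OF \<Gamma>_expansion[OF d(1) _ \<rho>] err]) (use t in simp)
    from abs_le_D2[OF this] have "m * t - (\<Gamma> d (l\<^sub>0 + t) - \<Gamma>\<^sub>0) \<le> m * t / 2"
      by (simp add: algebra_simps)
    then show "- (1 / a) \<le> \<Gamma> d (l\<^sub>0 + t)" using close \<Gamma>\<^sub>0 by linarith
    show "l\<^sub>0 - t \<le> l\<^sub>0 + t" using t by simp
    show "continuous_on {l\<^sub>0 - t..l\<^sub>0 + t} (\<Gamma> d)"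
      by (rule continuous_on_subset[OF \<Gamma>_continuous[OF d(1)]]) simp
  qed
  then obtain l where "l\<^sub>0 - t \<le> l" "l \<le> l\<^sub>0 + t" "\<Gamma> d l = - (1 / a)" by blast
  then show ?thesis using a(1) by (intro exI[of _ l]) (auto simp: abs_le_iff)
qed

section \<open>Trial vectors and their residuals\<close>

definition trial :: "real \<Rightarrow> real \<Rightarrow> real \<Rightarrow> complex" where
  "trial d l x = of_real (cauchy_kernel d (x - l)) * u x"

lemma trial_square_integrable:
  assumes "d > 0" shows "square_integrable (trial d l)"
proof (rule square_integrable_dominated[OF _ u])
  show "trial d l \<in> borel_measurable borel" unfolding trial_def by measurable
  show "cmod (trial d l x) \<le> (1 / d) * cmod (u x)" for x
    unfolding trial_def norm_mult norm_of_real by (intro mult_right_mono abs_kernel_le assms) simp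
qed

text \<open>The root condition makes the rank-one term exactly \<open>- u\<close>, so the residual
  is \<open>(ratio x - 1) * u x\<close>. It vanishes for \<open>\<bar>x - l\<bar> > d\<close>; on
  the remaining interval, of length \<open>2 * d\<close>, the distance to \<open>l\<^sub>0\<close>
  is at most \<open>2 * t\<close>.\<close>

lemma trial_residual:
  assumes d: "0 < d" "d \<le> t" and l: "\<bar>l - l\<^sub>0\<bar> \<le> t" and root: "a * \<Gamma> d l = -1"
  obtains G where "(abs_L2 (trial d l), G) \<in> H u a"
    "(norm (G - of_real l *\<^sub>C abs_L2 (trial d l)))\<^sup>2 \<le> 2 * d * (K\<^sup>2 * (2 * t) ^ (2 * Suc k))"
proof -
  define w where "w x = of_real (x - l) * trial d l x" for x
  define ratio where "ratio x = (x - l) * cauchy_kernel d (x - l)" for x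
  have w_eq: "w x = of_real (ratio x) * u x" for x by (simp add: w_def ratio_def trial_def)
  have ratio_out: "ratio x = 1" if "d < \<bar>x - l\<bar>" for x
    using that d by (auto simp: ratio_def cauchy_kernel_def max_def power2_eq_square)
  have ratio_in: "0 \<le> ratio x" "ratio x \<le> 1" for x
  proof -
    show "0 \<le> ratio x" by (simp add: ratio_def cauchy_kernel_def power2_eq_square[symmetric])
    have "(x - l)\<^sup>2 \<le> (max \<bar>x - l\<bar> d)\<^sup>2" by (simp add: abs_le_square_iff[symmetric])
    moreover have "0 < (max \<bar>x - l\<bar> d)\<^sup>2" using d by (intro zero_less_power) simp
    ultimately have "(x - l)\<^sup>2 / (max \<bar>x - l\<bar> d)\<^sup>2 \<le> 1" by (simp only: divide_le_eq_1_pos)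
    then show "ratio x \<le> 1" by (simp add: ratio_def cauchy_kernel_def power2_eq_square)
  qed
  have w: "square_integrable w"
  proof (rule square_integrable_dominated[OF _ u, of _ 1])
    show "w \<in> borel_measurable borel" unfolding w_def trial_def by measurable
    show "cmod (w x) \<le> 1 * cmod (u x)" for x
      unfolding w_eq norm_mult norm_of_real using ratio_in[of x] by (intro mult_right_mono) auto
  qed
  obtain G where G: "(abs_L2 (trial d l), G) \<in> H u a"
    "G - of_real l *\<^sub>C abs_L2 (trial d l)
      = abs_L2 w + of_real a *\<^sub>C cinner (abs_L2 (trial d l)) (abs_L2 u) *\<^sub>C abs_L2 u"
    using H_abs_L2[OF trial_square_integrable[OF d(1)] w[unfolded w_def], of u a]
    unfolding w_def by metis
  have "cinner (abs_L2 (trial d l)) (abs_L2 u)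
      = (LINT x|lborel. of_real ((cmod (u x))\<^sup>2 * cauchy_kernel d (x - l)))"
    by (subst cinner_abs_L2[OF trial_square_integrable[OF d(1)] u])
       (simp add: trial_def complex_norm_square mult_ac del: of_real_power)
  also have "\<dots> = of_real (\<Gamma> d l)" unfolding \<Gamma>_def by (rule integral_complex_of_real)
  finally have "of_real a *\<^sub>C cinner (abs_L2 (trial d l)) (abs_L2 u) *\<^sub>C abs_L2 u = - abs_L2 u"
    using root by (simp add: scaleC_scaleC of_real_mult[symmetric] scaleC_minus_one del: of_real_mult)
  then have "G - of_real l *\<^sub>C abs_L2 (trial d l) = abs_L2 (\<lambda>x. w x - u x)"
    unfolding G(2) by (simp add: abs_L2_diff[OF w u, symmetric])
  then have "(norm (G - of_real l *\<^sub>C abs_L2 (trial d l)))\<^sup>2 = (LINT x|lborel. (cmod (w x - u x))\<^sup>2)"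
    by (simp add: norm_abs_L2 square_integrable_diff w u)
  also have "\<dots> \<le> (LINT x|lborel. K\<^sup>2 * (2 * t) ^ (2 * Suc k) * indicator {l - d..l + d} x)"
  proof (rule integral_mono)
    show "integrable lborel (\<lambda>x. (cmod (w x - u x))\<^sup>2)"
      by (rule square_integrable_integrable[OF square_integrable_diff[OF w u]])
    fix x
    show "(cmod (w x - u x))\<^sup>2 \<le> K\<^sup>2 * (2 * t) ^ (2 * Suc k) * indicator {l - d..l + d} x"
    proof (cases "\<bar>x - l\<bar> \<le> d")
      case True
      have "w x - u x = of_real (ratio x - 1) * u x" by (simp add: w_eq algebra_simps)
      then have "cmod (w x - u x) = \<bar>ratio x - 1\<bar> * cmod (u x)"
        by (simp only: norm_mult norm_of_real)
      also have "\<dots> \<le> 1 * cmod (u x)"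
        using ratio_in[of x] by (intro mult_right_mono) auto
      also have "\<dots> \<le> K * \<bar>x - l\<^sub>0\<bar> ^ Suc k" using order_bound[of x] by simp
      also have "\<dots> \<le> K * (2 * t) ^ Suc k"
        using True d l KV by (intro mult_left_mono power_mono) auto
      finally have "(cmod (w x - u x))\<^sup>2 \<le> (K * (2 * t) ^ Suc k)\<^sup>2" by (intro power_mono) auto
      also have "\<dots> = K\<^sup>2 * (2 * t) ^ (2 * Suc k)"
        by (simp only: power_mult_distrib power_mult[symmetric] mult.commute[of "Suc k"])
      finally show ?thesis using True by (simp add: indicator_def abs_le_iff)
    next
      case False
      then show ?thesis using ratio_out[of x] d by (simp add: w_eq)
    qed
  qed simp
  also have "\<dots> = 2 * d * (K\<^sup>2 * (2 * t) ^ (2 * Suc k))" using d by simp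
  finally show ?thesis using G(1) that by blast
qed

text \<open>By \<open>u_eq\<close> the difference is \<open>f\<^sub>0\<close> times the quantity
  estimated in \<open>kernel_difference_quotient\<close>.\<close>

lemma trial_near:
  assumes d: "0 < d" and l: "\<bar>l - l\<^sub>0\<bar> \<le> t" and \<rho>: "0 < \<rho>"
  shows "(norm (abs_L2 (trial d l) - abs_L2 f\<^sub>0))\<^sup>2 \<le> 2 * R t d \<rho> + 4 * V\<^sup>2 * d"
proof -
  define s where "s = l - l\<^sub>0"
  note tr = trial_square_integrable[OF d, of l]
  have "(norm (abs_L2 (trial d l) - abs_L2 f\<^sub>0))\<^sup>2 = (LINT x|lborel. (cmod (trial d l x - f\<^sub>0 x))\<^sup>2)"
    by (simp add: abs_L2_diff norm_abs_L2 tr f\<^sub>0 square_integrable_diff)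
  also have "\<dots> \<le> (LINT x|lborel. 2 * q d l x + 2 * V\<^sup>2 * indicator {l - d..l + d} x)"
  proof (rule integral_mono)
    show "integrable lborel (\<lambda>x. (cmod (trial d l x - f\<^sub>0 x))\<^sup>2)"
      by (rule square_integrable_integrable[OF square_integrable_diff[OF tr f\<^sub>0]])
    show "integrable lborel (\<lambda>x. 2 * q d l x + 2 * V\<^sup>2 * indicator {l - d..l + d} x)"
      by (intro Bochner_Integration.integrable_add
        Bochner_Integration.integrable_mult_right q_integrable d integrable_indicator_Icc)
    fix x
    have "trial d l x - f\<^sub>0 x = of_real (((x - l) + s) * cauchy_kernel d (x - l) - 1) * f\<^sub>0 x"
      by (simp add: trial_def u_eq s_def algebra_simps)
    then have "(cmod (trial d l x - f\<^sub>0 x))\<^sup>2 = (((x - l) + s) * cauchy_kernel d (x - l) - 1)\<^sup>2 * v x"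
      by (simp only: norm_mult norm_of_real power_mult_distrib power2_abs)
    also have "\<dots> \<le> (2 * (s\<^sup>2 / (max \<bar>x - l\<bar> d)\<^sup>2) + 2 * indicator {- d..d} (x - l)) * v x"
      by (intro mult_right_mono kernel_difference_quotient d) simp
    also have "\<dots> = 2 * q d l x + 2 * indicator {- d..d} (x - l) * v x"
      by (simp add: q_def s_def[symmetric] algebra_simps)
    also have "\<dots> \<le> 2 * q d l x + 2 * indicator {- d..d} (x - l) * V\<^sup>2"
      by (intro add_left_mono mult_left_mono v_le) auto
    also have "\<dots> = 2 * q d l x + 2 * V\<^sup>2 * indicator {l - d..l + d} x"
      by (auto simp: indicator_def)
    finally show "(cmod (trial d l x - f\<^sub>0 x))\<^sup>2
        \<le> 2 * q d l x + 2 * V\<^sup>2 * indicator {l - d..l + d} x" .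
  qed
  also have "\<dots> = 2 * (LINT x|lborel. q d l x) + 4 * V\<^sup>2 * d"
    using q_integrable[OF d] d by simp
  also have "\<dots> \<le> 2 * R t d \<rho> + 4 * V\<^sup>2 * d" using q_integral_le[OF d l \<rho>] by simp
  finally show ?thesis .
qed

section \<open>The eigenvector and the range of the shifted operator\<close>

lemma cinner_f\<^sub>0_u: "cinner (abs_L2 f\<^sub>0) (abs_L2 u) = of_real \<Gamma>\<^sub>0"
proof -
  have "cinner (abs_L2 f\<^sub>0) (abs_L2 u) = (LINT x|lborel. of_real ((x - l\<^sub>0) * v x))"
    by (subst cinner_abs_L2[OF f\<^sub>0 u])
       (simp add: u_eq complex_norm_square mult_ac del: of_real_power of_real_diff)
  then show ?thesis unfolding \<Gamma>\<^sub>0_def by (simp only: integral_complex_of_real)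
qed

text \<open>Multiplication by \<open>x - l\<^sub>0\<close> sends \<open>f\<^sub>0\<close> to
  \<open>u\<close>, and the condition on \<open>\<Gamma>\<^sub>0\<close> makes the rank-one term
  \<open>- u\<close>.\<close>

lemma eigenvector:
  assumes "a\<^sub>0 * \<Gamma>\<^sub>0 = -1"
  shows "(abs_L2 f\<^sub>0, of_real l\<^sub>0 *\<^sub>C abs_L2 f\<^sub>0) \<in> H u a\<^sub>0"
proof -
  have eq: "(\<lambda>x. of_real (x - l\<^sub>0) * f\<^sub>0 x) = u" by (rule ext) (rule u_eq[symmetric])
  obtain G where G: "(abs_L2 f\<^sub>0, G) \<in> H u a\<^sub>0"
    "G - of_real l\<^sub>0 *\<^sub>C abs_L2 f\<^sub>0
      = abs_L2 u + of_real a\<^sub>0 *\<^sub>C cinner (abs_L2 f\<^sub>0) (abs_L2 u) *\<^sub>C abs_L2 u"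
    using H_abs_L2[OF f\<^sub>0, of l\<^sub>0 u a\<^sub>0] u unfolding eq by metis
  have "G - of_real l\<^sub>0 *\<^sub>C abs_L2 f\<^sub>0 = 0"
    unfolding G(2) cinner_f\<^sub>0_u using assms
    by (simp add: scaleC_scaleC of_real_mult[symmetric] scaleC_minus_one del: of_real_mult)
  then show ?thesis using G(1) by simp
qed

text \<open>Preimages arise by cutting \<open>g\<close> off near \<open>l\<^sub>0\<close> and
  dividing by \<open>x - l\<^sub>0\<close>. Their pairing with \<open>u\<close> equals the pairing
  of the cut-off \<open>g\<close> with \<open>f\<^sub>0\<close>, which tends to 0 by orthogonality,
  so the rank-one term disappears in the limit.\<close>

lemma range_dense:
  assumes g: "cinner g (abs_L2 f\<^sub>0) = 0"
  obtains h w where "\<And>j. (h j, w j) \<in> H u a" "(\<lambda>j. w j - of_real l\<^sub>0 *\<^sub>C h j) \<longlonglongrightarrow> g"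
proof -
  obtain g' where g': "square_integrable g'" "g = abs_L2 g'" by (rule L2_cases)
  define B where "B j = {x. 1 / Suc j \<le> \<bar>x - l\<^sub>0\<bar>}" for j :: nat
  define gj where "gj j x = indicator (B j) x * g' x" for j x
  define hj where "hj j x = inverse (of_real (x - l\<^sub>0)) * gj j x" for j x
  have B: "B j \<in> sets borel" for j unfolding B_def by measurable
  have gj: "square_integrable (gj j)" for j
    unfolding gj_def by (rule square_integrable_indicator[OF g'(1) B])
  have hj: "square_integrable (hj j)" for j
    unfolding hj_def gj_def
  proof (rule square_integrable_mult_indicator[OF g'(1) B, where C = "Suc j"])
    show "cmod (inverse (of_real (x - l\<^sub>0))) \<le> real (Suc j)" if "x \<in> B j" for x
    proof -
      have "inverse \<bar>x - l\<^sub>0\<bar> \<le> inverse (1 / real (Suc j))"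
        using that by (intro le_imp_inverse_le) (auto simp: B_def)
      then show ?thesis by (simp add: norm_inverse del: of_real_diff)
    qed
  qed measurable
  have xh: "(\<lambda>x. of_real (x - l\<^sub>0) * hj j x) = gj j" for j
  proof (rule ext)
    fix x
    show "of_real (x - l\<^sub>0) * hj j x = gj j x"
      by (cases "x = l\<^sub>0") (simp_all add: hj_def gj_def B_def del: of_real_diff)
  qed
  have "\<exists>w. (abs_L2 (hj j), w) \<in> H u a \<and> w - of_real l\<^sub>0 *\<^sub>C abs_L2 (hj j)
      = abs_L2 (gj j) + of_real a *\<^sub>C cinner (abs_L2 (hj j)) (abs_L2 u) *\<^sub>C abs_L2 u" for j
    using H_abs_L2[where f = "hj j" and l = l\<^sub>0 and u = u and a = a, OF hj] gj[of j]
    unfolding xh by metis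
  then obtain w where w: "\<And>j. (abs_L2 (hj j), w j) \<in> H u a"
    "\<And>j. w j - of_real l\<^sub>0 *\<^sub>C abs_L2 (hj j)
      = abs_L2 (gj j) + of_real a *\<^sub>C cinner (abs_L2 (hj j)) (abs_L2 u) *\<^sub>C abs_L2 u"
    by metis
  have hu: "cinner (abs_L2 (hj j)) (abs_L2 u) = cinner (abs_L2 (gj j)) (abs_L2 f\<^sub>0)" for j
  proof -
    have "hj j x * cnj (u x) = gj j x * cnj (f\<^sub>0 x)" for x
      using fun_cong[OF xh[of j], of x, symmetric] by (simp add: u_eq mult_ac del: of_real_diff)
    then show ?thesis by (simp add: cinner_abs_L2 hj gj u f\<^sub>0)
  qed
  have lim: "(\<lambda>j. abs_L2 (gj j)) \<longlonglongrightarrow> g"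
    unfolding g'(2) gj_def
  proof (rule cutoff_tendsto[OF g'(1) B])
    have "\<forall>\<^sub>F j in sequentially. x \<in> B j" if "x \<noteq> l\<^sub>0" for x
    proof -
      have "\<forall>\<^sub>F j in sequentially. 1 / real (Suc j) < \<bar>x - l\<^sub>0\<bar>"
        using order_tendstoD(2)[OF LIMSEQ_Suc[OF lim_1_over_n[where ?'a = real]], of "\<bar>x - l\<^sub>0\<bar>"] that by simp
      then show ?thesis by eventually_elim (simp add: B_def)
    qed
    moreover have "AE x in lborel. x \<noteq> l\<^sub>0" by (rule AE_lborel_singleton)
    ultimately show "AE x in lborel. \<forall>\<^sub>F j in sequentially. x \<in> B j" by auto
  qed
  have "(\<lambda>j. cmod (cinner (abs_L2 (gj j)) (abs_L2 f\<^sub>0))) \<longlonglongrightarrow> 0"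
  proof (rule tendsto_sandwich[OF _ _ tendsto_const])
    show "(\<lambda>j. norm (abs_L2 (gj j) - g) * norm (abs_L2 f\<^sub>0)) \<longlonglongrightarrow> 0"
      by (intro tendsto_mult_left_zero tendsto_norm_zero LIM_zero lim)
    show "\<forall>\<^sub>F j in sequentially. cmod (cinner (abs_L2 (gj j)) (abs_L2 f\<^sub>0))
        \<le> norm (abs_L2 (gj j) - g) * norm (abs_L2 f\<^sub>0)"
      using cinner_Cauchy_Schwarz[of "abs_L2 (gj _) - g" "abs_L2 f\<^sub>0"]
      by (intro always_eventually allI) (simp add: cinner_diff_left g)
  qed simp
  then have "(\<lambda>j. norm (of_real a *\<^sub>C cinner (abs_L2 (hj j)) (abs_L2 u) *\<^sub>C abs_L2 u)) \<longlonglongrightarrow> 0"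
    unfolding hu norm_scaleC by (intro tendsto_mult_right_zero tendsto_mult_left_zero)
  then have "(\<lambda>j. abs_L2 (gj j) + of_real a *\<^sub>C cinner (abs_L2 (hj j)) (abs_L2 u) *\<^sub>C abs_L2 u)
      \<longlonglongrightarrow> g + 0"
    by (intro tendsto_add lim) (rule tendsto_norm_zero_cancel)
  then show ?thesis using w(1) that[of "\<lambda>j. abs_L2 (hj j)" w] unfolding w(2) by simp
qed

end

section \<open>Schwartz functions with a zero\<close>

lemma schwartz_bounded:
  assumes "schwartz u"
  obtains C where "0 \<le> C" "\<And>x. \<bar>x\<bar> ^ k * cmod (nth_derivative j u x) \<le> C"
proof -
  have "bounded (range (\<lambda>x. of_real (x ^ k) * nth_derivative j u x))"
    using assms by (simp add: schwartz_def)
  then obtain C where "\<And>x. cmod (of_real (x ^ k) * nth_derivative j u x) \<le> C"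
    by (auto simp: bounded_iff)
  then have C: "\<bar>x\<bar> ^ k * cmod (nth_derivative j u x) \<le> C" for x
    by (simp add: norm_mult norm_power)
  have "0 \<le> \<bar>0::real\<bar> ^ k * cmod (nth_derivative j u 0)" by simp
  also have "\<dots> \<le> C" by (rule C)
  finally show ?thesis using C that by blast
qed

lemma schwartz_has_derivative:
  assumes "schwartz u"
  shows "(nth_derivative j u has_vector_derivative nth_derivative (Suc j) u x) (at x)"
proof -
  have "nth_derivative j u differentiable (at x)" using assms by (simp add: schwartz_def)
  then show ?thesis by (simp add: vector_derivative_works nth_derivative_def)
qed

text \<open>Descent from the bounded \<open>n\<close>-th derivative: each step applies the mean
  value inequality on the segment from \<open>l\<close> to \<open>x\<close>, using that the lower
  derivative vanishes at \<open>l\<close>. The factorials of Taylor's formula are not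
  tracked.\<close>

lemma vanishing_derivative_bound:
  assumes u: "schwartz u" and van: "vanishes_to_order u n l"
    and K: "\<And>x. cmod (nth_derivative n u x) \<le> K" and "i \<le> n"
  shows "cmod (nth_derivative (n - i) u x) \<le> K * \<bar>x - l\<bar> ^ i"
  using \<open>i \<le> n\<close>
proof (induction i arbitrary: x)
  case 0
  then show ?case using K by simp
next
  case (Suc i)
  have K0: "0 \<le> K" using norm_ge_zero K by (rule order_trans)
  \<comment> \<open>The subtraction is on naturals; the identity rests on
    \<open>Suc i \<le> n\<close>.\<close>
  have ni: "n - i = Suc (n - Suc i)" using Suc.prems by simp
  have zero: "nth_derivative (n - Suc i) u l = 0"
    using van Suc.prems by (simp add: vanishes_to_order_def)
  have "norm (nth_derivative (n - Suc i) u x - nth_derivative (n - Suc i) u l)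
      \<le> (K * \<bar>x - l\<bar> ^ i) * norm (x - l)"
  proof (rule differentiable_bound[where S = "closed_segment l x"])
    fix y assume y: "y \<in> closed_segment l x"
    show "(nth_derivative (n - Suc i) u has_derivative (\<lambda>h. h *\<^sub>R nth_derivative (n - i) u y))
        (at y within closed_segment l x)"
      using schwartz_has_derivative[OF u, of "n - Suc i" y] unfolding ni[symmetric]
      by (simp add: has_vector_derivative_def has_derivative_at_withinI)
    show "onorm (\<lambda>h. h *\<^sub>R nth_derivative (n - i) u y) \<le> K * \<bar>x - l\<bar> ^ i"
    proof (rule onorm_le)
      have "\<bar>y - l\<bar> \<le> \<bar>x - l\<bar>" using y by (auto simp: closed_segment_eq_real_ivl split: if_splits)
      then have "K * \<bar>y - l\<bar> ^ i \<le> K * \<bar>x - l\<bar> ^ i"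
        using K0 by (intro mult_left_mono power_mono) auto
      then have "cmod (nth_derivative (n - i) u y) \<le> K * \<bar>x - l\<bar> ^ i"
        using Suc.IH[of y] Suc.prems by simp
      then show "norm (h *\<^sub>R nth_derivative (n - i) u y) \<le> K * \<bar>x - l\<bar> ^ i * norm h" for h
        by (simp add: mult_left_mono mult.commute)
    qed
  qed auto
  then show ?case by (simp add: zero mult_ac)
qed

lemma vanishes_to_order_bound:
  assumes u: "schwartz u" and van: "vanishes_to_order u n l"
  obtains K where "0 \<le> K" "\<And>x. cmod (u x) \<le> K * \<bar>x - l\<bar> ^ n"
proof -
  obtain K where K: "0 \<le> K" "\<And>x. \<bar>x\<bar> ^ 0 * cmod (nth_derivative n u x) \<le> K"
    using schwartz_bounded[OF u, where k = 0 and j = n] by blast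
  have "cmod (u x) \<le> K * \<bar>x - l\<bar> ^ n" for x
    using vanishing_derivative_bound[OF u van, of K n x] K(2) by (simp add: nth_derivative_def)
  then show ?thesis using K(1) that by blast
qed

text \<open>Bounds on \<open>u\<close> and on \<open>x\<close> times \<open>u\<close> together give
  decay like \<open>1 / (1 + x\<^sup>2)\<close> for the square.\<close>

lemma schwartz_square_integrable:
  assumes u: "schwartz u" shows "square_integrable u"
proof -
  have u0: "nth_derivative 0 u = u" by (simp add: nth_derivative_def)
  obtain A where A: "\<And>x. cmod (u x) \<le> A"
    using schwartz_bounded[OF u, where k = 0 and j = 0] unfolding u0 by auto
  obtain B where B: "\<And>x. \<bar>x\<bar> * cmod (u x) \<le> B"
    using schwartz_bounded[OF u, where k = 1 and j = 0] unfolding u0 by auto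
  show ?thesis
  proof (rule square_integrable_bound)
    have "continuous_on UNIV u"
      using schwartz_has_derivative[OF u, of 0] unfolding u0
      by (intro continuous_at_imp_continuous_on ballI has_vector_derivative_continuous)
    then show "u \<in> borel_measurable borel" by (rule borel_measurable_continuous_onI)
    have "integrable lborel (\<lambda>x::real. inverse (1 + x\<^sup>2))"
      using integrable_inverse_1_plus_square by (simp add: set_integrable_def einterval_def)
    then show "integrable lborel (\<lambda>x::real. (A\<^sup>2 + B\<^sup>2) * inverse (1 + x\<^sup>2))"
      by (rule Bochner_Integration.integrable_mult_right)
    show "(cmod (u x))\<^sup>2 \<le> (A\<^sup>2 + B\<^sup>2) * inverse (1 + x\<^sup>2)" for x
    proof -
      have "(cmod (u x))\<^sup>2 \<le> A\<^sup>2" using A[of x] by (intro power_mono) auto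
      moreover have "(\<bar>x\<bar> * cmod (u x))\<^sup>2 \<le> B\<^sup>2" using B[of x] by (intro power_mono) auto
      ultimately have "(cmod (u x))\<^sup>2 * (1 + x\<^sup>2) \<le> A\<^sup>2 + B\<^sup>2"
        by (simp add: power_mult_distrib algebra_simps)
      moreover have "0 < 1 + x\<^sup>2" by (simp add: add_pos_nonneg)
      ultimately show ?thesis by (simp add: field_simps)
    qed
  qed
qed

section \<open>Spectral concentration\<close>

lemma le_0_if_le_small_multiples:
  fixes X c :: real
  assumes "0 \<le> c" and "\<And>e. e > 0 \<Longrightarrow> X \<le> e * c"
  shows "X \<le> 0"
proof (rule field_le_epsilon)
  fix e :: real assume e: "e > 0"
  \<comment> \<open>The shift \<open>c + 1\<close> covers \<open>c = 0\<close>.\<close>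
  have "X \<le> e / (c + 1) * c" using assms e by (intro assms(2)) simp
  also have "\<dots> \<le> e" using assms(1) e by (simp add: field_simps)
  finally show "X \<le> 0 + e" by simp
qed

context spectral_resolution
begin

text \<open>With zero residual, \<open>proj_away_le\<close> annihilates every set at positive
  distance from \<open>l\<close>, and countably many of these exhaust the complement of the
  point.\<close>

lemma proj_eigenvector:
  assumes "(f, of_real l *\<^sub>C f) \<in> T" shows "E {l} f = f"
proof -
  have "E {x. d \<le> \<bar>x - l\<bar>} f = 0" if "d > 0" for d
    using proj_away_le[OF assms that, of l] that by (simp add: mult_le_0_iff)
  then have "emeasure (\<mu> f) {x. 1 / Suc j \<le> \<bar>x - l\<bar>} = 0" for j :: nat
    by (subst emeasure_\<mu>) simp_all
  then have "emeasure (\<mu> f) (\<Union>j::nat. {x. 1 / Suc j \<le> \<bar>x - l\<bar>}) = 0"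
    by (intro emeasure_UN_eq_0) auto
  also have "(\<Union>j::nat. {x. 1 / Suc j \<le> \<bar>x - l\<bar>}) = - {l}"
  proof (intro set_eqI iffI)
    fix x assume "x \<in> - {l}"
    then obtain j where "inverse (real (Suc j)) < \<bar>x - l\<bar>"
      using reals_Archimedean[of "\<bar>x - l\<bar>"] by auto
    then show "x \<in> (\<Union>j::nat. {x. 1 / Suc j \<le> \<bar>x - l\<bar>})"
      by (auto simp: inverse_eq_divide intro: less_imp_le)
  qed auto
  finally have "E (- {l}) f = 0" by (simp add: emeasure_\<mu>)
  then show ?thesis by (simp add: proj_compl)
qed

text \<open>\<open>proj_near_le\<close> on a one-point set allows an arbitrarily small
  radius.\<close>

lemma proj_point_range:
  assumes "(h, g) \<in> T" shows "E {l} (g - of_real l *\<^sub>C h) = 0"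
proof -
  have "norm (E {l} (g - of_real l *\<^sub>C h)) \<le> 0"
    by (rule le_0_if_le_small_multiples[of "norm h"], simp)
       (rule proj_near_le[OF assms]; simp)
  then show ?thesis by simp
qed

end

text \<open>Contractivity makes the error of replacing \<open>g\<close> by some \<open>w j\<close>
  uniform in \<open>a\<close>, so strong convergence need only be known on the approximants.\<close>

lemma contractions_tendsto_0:
  fixes P :: "'a \<Rightarrow> 'b::real_normed_vector \<Rightarrow> 'b"
  assumes contr: "\<And>a f. norm (P a f) \<le> norm f"
    and diff: "\<And>a f g. P a (f - g) = P a f - P a g"
    and w: "w \<longlonglongrightarrow> g" and null: "\<And>j. ((\<lambda>a. P a (w j)) \<longlongrightarrow> 0) F"
  shows "((\<lambda>a. P a g) \<longlongrightarrow> 0) F"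
proof (rule tendstoI)
  fix e :: real assume e: "e > 0"
  obtain j where j: "norm (g - w j) < e / 2"
    using LIMSEQ_D[OF w, of "e / 2"] e by (auto simp: norm_minus_commute)
  have "\<forall>\<^sub>F a in F. dist (P a (w j)) 0 < e / 2"
    using null e by (intro tendstoD) auto
  then show "\<forall>\<^sub>F a in F. dist (P a g) 0 < e"
  proof eventually_elim
    case (elim a)
    have "norm (P a g) \<le> norm (P a (w j)) + norm (P a (g - w j))"
      unfolding diff by (rule norm_triangle_sub)
    also have "\<dots> < e / 2 + e / 2"
      using elim j contr[of a "g - w j"] by (intro add_strict_mono) (auto intro: le_less_trans)
    finally show ?case by simp
  qed
qed

lemma tendsto_0_if_norm_square_le:
  fixes X :: "'a \<Rightarrow> 'b::real_normed_vector"
  assumes "\<forall>\<^sub>F a in F. (norm (X a))\<^sup>2 \<le> Y a" "(Y \<longlongrightarrow> 0) F"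
  shows "(X \<longlongrightarrow> 0) F"
proof (rule Lim_null_comparison)
  show "((\<lambda>a. sqrt (Y a)) \<longlongrightarrow> 0) F" using tendsto_real_sqrt[OF assms(2)] by simp
  show "\<forall>\<^sub>F a in F. norm (X a) \<le> sqrt (Y a)"
    using assms(1) by eventually_elim (rule real_le_rsqrt)
qed

context vanishing_vector
begin

text \<open>The zero of \<open>u\<close> makes the integrand equal to the integrable function
  \<open>(x - l\<^sub>0) * v x\<close>. Excising \<open>\<bar>x - l\<^sub>0\<bar> < e\<close> then
  changes the integral by at most \<open>e * m\<close>.\<close>

lemma pv_integral_eq: "pv_integral (\<lambda>x. of_real ((cmod (u x))\<^sup>2)) l\<^sub>0 = of_real \<Gamma>\<^sub>0"
proof -
  define A where "A e = {x. \<bar>x - l\<^sub>0\<bar> \<ge> e}" for e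
  define I where "I e = (LINT x:A e|lborel. of_real ((cmod (u x))\<^sup>2) / complex_of_real (x - l\<^sub>0))" for e
  have [measurable]: "A e \<in> sets borel" for e unfolding A_def by measurable
  have "norm (I e - of_real \<Gamma>\<^sub>0) \<le> e * m" if e: "e > 0" for e
  proof -
    have cut: "integrable lborel (\<lambda>x. indicator (A e) x * ((x - l\<^sub>0) * v x))"
      using integrable_real_mult_indicator[OF _ v_moment, of "A e"] by (simp add: mult.commute)
    have "indicator (A e) x *\<^sub>R (of_real ((cmod (u x))\<^sup>2) / complex_of_real (x - l\<^sub>0))
        = of_real (indicator (A e) x * ((x - l\<^sub>0) * v x))" for x
      by (cases "x = l\<^sub>0")
         (auto simp: u_norm_eq scaleR_conv_of_real power2_eq_square[of "x - l\<^sub>0"] simp del: of_real_diff)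
    then have "I e = (LINT x|lborel. of_real (indicator (A e) x * ((x - l\<^sub>0) * v x)))"
      by (simp only: I_def set_lebesgue_integral_def)
    also have "\<dots> = of_real (LINT x|lborel. indicator (A e) x * ((x - l\<^sub>0) * v x))"
      by (rule integral_complex_of_real)
    finally have "norm (I e - of_real \<Gamma>\<^sub>0)
        = \<bar>(LINT x|lborel. indicator (A e) x * ((x - l\<^sub>0) * v x)) - \<Gamma>\<^sub>0\<bar>"
      by (simp only: of_real_diff[symmetric] norm_of_real)
    also have "\<dots> = \<bar>LINT x|lborel. indicator (A e) x * ((x - l\<^sub>0) * v x) - (x - l\<^sub>0) * v x\<bar>"
      unfolding \<Gamma>\<^sub>0_def using cut v_moment by simp
    also have "\<dots> \<le> (LINT x|lborel. e * v x)"
    proof (rule order_trans[OF integral_abs_bound], rule integral_mono)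
      show "\<bar>indicator (A e) x * ((x - l\<^sub>0) * v x) - (x - l\<^sub>0) * v x\<bar> \<le> e * v x" for x
        using e by (cases "x \<in> A e") (auto simp: A_def abs_mult intro: mult_right_mono)
    qed (use cut v_moment v in simp_all)
    finally show ?thesis by (simp add: m_def)
  qed
  then have "\<forall>\<^sub>F e in at_right 0. norm (I e - of_real \<Gamma>\<^sub>0) \<le> e * m"
    by (auto simp: eventually_at_filter)
  moreover have "((\<lambda>e. e * m) \<longlongrightarrow> 0) (at_right 0)"
    by (intro tendsto_mult_left_zero tendsto_ident_at)
  ultimately have "((\<lambda>e. I e - of_real \<Gamma>\<^sub>0) \<longlongrightarrow> 0) (at_right 0)"
    by (rule Lim_null_comparison)
  then have "(I \<longlongrightarrow> of_real \<Gamma>\<^sub>0) (at_right 0)" by (rule LIM_zero_cancel)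
  then have "Lim (at_right 0) I = of_real \<Gamma>\<^sub>0" by (intro tendsto_Lim) simp_all
  then show ?thesis unfolding pv_integral_def I_def A_def .
qed

lemma m_pos:
  assumes "abs_L2 u \<noteq> 0" shows "0 < m"
proof (rule ccontr)
  assume "\<not> 0 < m"
  moreover have "0 \<le> m" by (simp add: m_def)
  ultimately have "m = 0" by linarith
  then have "(LINT x|lborel. v x) = 0" by (simp add: m_def)
  then have "AE x in lborel. v x = 0"
    using v by (subst (asm) integral_nonneg_eq_0_iff_AE) auto
  then have "AE x in lborel. u x = 0" by eventually_elim (simp add: u_eq)
  then have "abs_L2 u = abs_L2 (\<lambda>_. 0)" by (intro abs_L2_eqI u square_integrable_zero)
  then show False using assms by (simp add: zero_L2_def)
qed

lemma norm_f\<^sub>0: "(norm (abs_L2 f\<^sub>0))\<^sup>2 = m"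
  by (simp add: norm_abs_L2 f\<^sub>0 m_def)

lemma spectrum_concentrated_H:
  assumes spec: "\<And>a. spectral_measure (H u a) (E a)"
    and nz: "abs_L2 u \<noteq> 0" and root: "a\<^sub>0 * \<Gamma>\<^sub>0 = -1" and p: "p < 2 * real (Suc k)"
  shows "spectrum_concentrated (H u) E l\<^sub>0 a\<^sub>0 p"
proof -
  have sr: "spectral_resolution (H u a) (E a)" for a
    by (rule spectral_resolution.intro[OF adjoint_H spec])
  have m: "0 < m" by (rule m_pos[OF nz])
  have a\<^sub>0: "a\<^sub>0 \<noteq> 0" using root by auto
  define N where "N = 2 * Suc k"
  \<comment> \<open>Midpoint of \<open>max p 1\<close> and \<open>N\<close>. Here
    \<open>r > p\<close> gives the concentration order, \<open>r > 1\<close> gives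
    \<open>d a \<le> t a\<close> eventually, and \<open>r < N\<close> makes \<open>Z\<close> tend to
    0.\<close>
  define r where "r = (max p 1 + real N) / 2"
  have r: "p < r" "1 < r" "r < real N" using p by (auto simp: r_def N_def)
  \<comment> \<open>Chosen so that \<open>\<bar>a\<bar> \<ge> \<bar>a\<^sub>0\<bar> / 2\<close>
    implies the hypothesis \<open>close\<close> of \<open>ex_root\<close>.\<close>
  define C where "C = 4 / (m * a\<^sub>0\<^sup>2)"
  have C: "0 < C" using m a\<^sub>0 by (simp add: C_def)
  define s where "s a = \<bar>a - a\<^sub>0\<bar>" for a
  define d where "d a = s a powr r" for a
  define t where "t a = C * s a" for a
  \<comment> \<open>An intermediate scale: both \<open>\<rho> a\<close> and
    \<open>(t a)\<^sup>2 / (\<rho> a)\<^sup>2\<close> tend to 0.\<close>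
  define \<rho> where "\<rho> a = sqrt (s a)" for a
  \<comment> \<open>The choice is meaningful only for \<open>a\<close> near
    \<open>a\<^sub>0\<close>; \<open>good\<close> below records this as an eventual
    property.\<close>
  define lam where "lam a = (SOME l. \<bar>l - l\<^sub>0\<bar> \<le> t a \<and> a * \<Gamma> (d a) l = -1)" for a
  define J where "J a = {lam a - d a<..<lam a + d a}" for a
  \<comment> \<open>Up to a factor 2, this is the squared residual bound of
    \<open>trial_residual\<close> divided by \<open>(d a)\<^sup>2\<close>; it has order
    \<open>s a powr (N - r)\<close>.\<close>
  define Z where "Z a = K\<^sup>2 * (2 * t a) ^ N / d a" for a
  define R' where "R' a = R (t a) (d a) (\<rho> a)" for a
  define f where "f = abs_L2 f\<^sub>0"
  define F where "F a = abs_L2 (trial (d a) (lam a))" for a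

  have s: "(s \<longlongrightarrow> 0) (at a\<^sub>0)"
    unfolding s_def by (intro tendsto_rabs_zero LIM_zero tendsto_ident_at)
  have s_pos: "\<forall>\<^sub>F a in at a\<^sub>0. 0 < s a"
    unfolding s_def by (simp add: eventually_at_filter)
  have s_powr: "((\<lambda>a. s a powr e) \<longlongrightarrow> 0) (at a\<^sub>0)" if "e > 0" for e
    by (rule tendsto_zero_powrI[OF s tendsto_const]) (use that in \<open>auto simp: s_def\<close>)
  have d: "(d \<longlongrightarrow> 0) (at a\<^sub>0)" unfolding d_def using r by (intro s_powr) simp
  have t: "(t \<longlongrightarrow> 0) (at a\<^sub>0)" unfolding t_def by (intro tendsto_mult_right_zero s)
  have Z: "(Z \<longlongrightarrow> 0) (at a\<^sub>0)"
  proof (rule Lim_transform_eventually)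
    show "((\<lambda>a. K\<^sup>2 * (2 * C) ^ N * s a powr (real N - r)) \<longlongrightarrow> 0) (at a\<^sub>0)"
      using r by (intro tendsto_mult_right_zero s_powr) simp
    show "\<forall>\<^sub>F a in at a\<^sub>0. K\<^sup>2 * (2 * C) ^ N * s a powr (real N - r) = Z a"
      using s_pos
      by eventually_elim
         (simp add: Z_def t_def d_def powr_diff powr_realpow power_mult_distrib mult.assoc)
  qed
  have R': "(R' \<longlongrightarrow> 0) (at a\<^sub>0)"
  proof (rule Lim_transform_eventually)
    have "((\<lambda>a. pi / 2 * Z a + 2 * sqrt (s a) * V\<^sup>2 + C\<^sup>2 * s a * m)
        \<longlongrightarrow> pi / 2 * 0 + 2 * sqrt 0 * V\<^sup>2 + C\<^sup>2 * 0 * m) (at a\<^sub>0)"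
      by (intro tendsto_intros Z s)
    then show "((\<lambda>a. pi / 2 * Z a + 2 * sqrt (s a) * V\<^sup>2 + C\<^sup>2 * s a * m) \<longlongrightarrow> 0) (at a\<^sub>0)" by simp
    show "\<forall>\<^sub>F a in at a\<^sub>0. pi / 2 * Z a + 2 * sqrt (s a) * V\<^sup>2 + C\<^sup>2 * s a * m = R' a"
      using s_pos
    proof eventually_elim
      case (elim a)
      \<comment> \<open>As \<open>N = 2 * k + 2\<close>, the first summand of \<open>R\<close> is
        \<open>Z a\<close> up to a factor, which explains \<open>pi / 2\<close>.\<close>
      have "Z a = 4 * (K\<^sup>2 * (2 * t a) ^ (2 * k) * (t a)\<^sup>2 / d a)"
        by (simp add: Z_def N_def power2_eq_square)
      moreover have "C\<^sup>2 * s a = (t a)\<^sup>2 / (\<rho> a)\<^sup>2"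
        using elim by (simp add: t_def \<rho>_def power_mult_distrib power2_eq_square[of "s a"])
      ultimately show ?case by (simp add: R'_def R_def \<rho>_def)
    qed
  qed
  have good: "\<forall>\<^sub>F a in at a\<^sub>0. 0 < s a \<and> 0 < d a \<and> d a \<le> t a \<and> \<bar>lam a - l\<^sub>0\<bar> \<le> t a
      \<and> a * \<Gamma> (d a) (lam a) = -1"
  proof -
    have "((\<lambda>a. \<bar>a\<bar>) \<longlongrightarrow> \<bar>a\<^sub>0\<bar>) (at a\<^sub>0)" by (intro tendsto_intros)
    then have "\<forall>\<^sub>F a in at a\<^sub>0. \<bar>a\<^sub>0\<bar> / 2 < \<bar>a\<bar>" by (rule order_tendstoD) (use a\<^sub>0 in simp)
    moreover have "\<forall>\<^sub>F a in at a\<^sub>0. s a powr (r - 1) < C"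
      by (rule order_tendstoD(2)[OF s_powr C]) (use r in simp)
    moreover have "((\<lambda>a. R' a + 12 * V\<^sup>2 * d a) \<longlongrightarrow> 0 + 12 * V\<^sup>2 * 0) (at a\<^sub>0)"
      by (intro tendsto_intros R' d)
    then have "\<forall>\<^sub>F a in at a\<^sub>0. R' a + 12 * V\<^sup>2 * d a < m / 4"
      by (rule order_tendstoD) (use m in simp)
    ultimately show ?thesis
      using s_pos
    proof eventually_elim
      case (elim a)
      have a: "a \<noteq> 0" using elim(1) by auto
      have dpos: "0 < d a" using elim(4) by (simp add: d_def)
      have dt: "d a \<le> t a"
        using mult_left_mono[OF less_imp_le[OF elim(2)], of "s a"] elim(4)
        by (simp add: d_def t_def powr_diff mult.commute)
      have close: "\<bar>1 / a - 1 / a\<^sub>0\<bar> \<le> m * t a / 2"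
      proof -
        have "1 / a - 1 / a\<^sub>0 = (a\<^sub>0 - a) / (a * a\<^sub>0)" using a a\<^sub>0 by (simp add: field_simps)
        then have "\<bar>1 / a - 1 / a\<^sub>0\<bar> = s a / (\<bar>a\<bar> * \<bar>a\<^sub>0\<bar>)"
          by (simp add: s_def abs_mult abs_minus_commute)
        also have "\<dots> \<le> s a / (\<bar>a\<^sub>0\<bar> / 2 * \<bar>a\<^sub>0\<bar>)"
          using elim(1,4) a a\<^sub>0 by (intro divide_left_mono mult_right_mono mult_pos_pos) auto
        also have "\<dots> = m * t a / 2"
          using m a\<^sub>0 by (simp add: t_def C_def power2_eq_square abs_mult_self_eq)
        finally show ?thesis .
      qed
      have "\<exists>l. \<bar>l - l\<^sub>0\<bar> \<le> t a \<and> a * \<Gamma> (d a) l = -1"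
        by (rule ex_root[OF a a\<^sub>0 root dpos dt _ close, of "\<rho> a"])
           (use elim(3,4) in \<open>auto simp: \<rho>_def R'_def\<close>)
      then have "\<bar>lam a - l\<^sub>0\<bar> \<le> t a \<and> a * \<Gamma> (d a) (lam a) = -1"
        unfolding lam_def by (rule someI_ex)
      then show ?case using elim(4) dpos dt by simp
    qed
  qed
  have J: "J a \<in> sets borel" for a by (simp add: J_def)
  have emJ: "emeasure lborel (J a) = ennreal (2 * d a)" for a
    by (simp add: J_def d_def)
  note proj_diff = spectral_resolution.proj_diff[OF sr J]
    and proj_add = spectral_resolution.proj_add[OF sr J]
    and proj_scaleC = spectral_resolution.proj_scaleC[OF sr J]
    and proj_norm_le = spectral_resolution.proj_norm_le[OF sr J]

  have F: "((\<lambda>a. F a - f) \<longlongrightarrow> 0) (at a\<^sub>0)"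
  proof (rule tendsto_0_if_norm_square_le)
    have "((\<lambda>a. 2 * R' a + 4 * V\<^sup>2 * d a) \<longlongrightarrow> 2 * 0 + 4 * V\<^sup>2 * 0) (at a\<^sub>0)"
      by (intro tendsto_intros R' d)
    then show "((\<lambda>a. 2 * R' a + 4 * V\<^sup>2 * d a) \<longlongrightarrow> 0) (at a\<^sub>0)" by simp
    show "\<forall>\<^sub>F a in at a\<^sub>0. (norm (F a - f))\<^sup>2 \<le> 2 * R' a + 4 * V\<^sup>2 * d a"
      using good unfolding F_def f_def R'_def
      by eventually_elim (rule trial_near, auto simp: \<rho>_def)
  qed
  have residual: "((\<lambda>a. F a - E a (J a) (F a)) \<longlongrightarrow> 0) (at a\<^sub>0)"
  proof (rule tendsto_0_if_norm_square_le)
    show "((\<lambda>a. 2 * Z a) \<longlongrightarrow> 0) (at a\<^sub>0)" by (intro tendsto_mult_right_zero Z)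
    show "\<forall>\<^sub>F a in at a\<^sub>0. (norm (F a - E a (J a) (F a)))\<^sup>2 \<le> 2 * Z a"
      using good
    proof eventually_elim
      case (elim a)
      then have dpos: "0 < d a" by simp
      obtain G where G: "(F a, G) \<in> H u a"
        "(norm (G - of_real (lam a) *\<^sub>C F a))\<^sup>2 \<le> 2 * d a * (K\<^sup>2 * (2 * t a) ^ N)"
        using trial_residual[of "d a" "t a" "lam a" a] elim unfolding F_def N_def by metis
      define n where "n = norm (F a - E a (J a) (F a))"
      \<comment> \<open>Removing an open interval leaves exactly the closed set treated by
        \<open>proj_away_le\<close>.\<close>
      have "- J a = {x. d a \<le> \<bar>x - lam a\<bar>}" by (auto simp: J_def)
      then have n: "n = norm (E a {x. d a \<le> \<bar>x - lam a\<bar>} (F a))"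
        using spectral_resolution.proj_compl[OF sr J, of a a "F a"] by (simp add: n_def)
      have "(d a * n)\<^sup>2 \<le> (norm (G - of_real (lam a) *\<^sub>C F a))\<^sup>2"
        unfolding n using dpos
        by (intro power_mono spectral_resolution.proj_away_le[OF sr G(1) dpos]) auto
      also note G(2)
      finally have "d a * (d a * n\<^sup>2) \<le> d a * (2 * (K\<^sup>2 * (2 * t a) ^ N))"
        by (simp add: power2_eq_square mult_ac)
      then have "d a * n\<^sup>2 \<le> 2 * (K\<^sup>2 * (2 * t a) ^ N)" using dpos by simp
      then show ?case using dpos by (simp add: n_def Z_def field_simps)
    qed
  qed
  have on_f: "((\<lambda>a. E a (J a) f - f) \<longlongrightarrow> 0) (at a\<^sub>0)"
  proof -
    have "((\<lambda>a. E a (J a) (f - F a)) \<longlongrightarrow> 0) (at a\<^sub>0)"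
    proof (rule Lim_null_comparison)
      show "((\<lambda>a. norm (F a - f)) \<longlongrightarrow> 0) (at a\<^sub>0)" by (rule tendsto_norm_zero[OF F])
      show "\<forall>\<^sub>F a in at a\<^sub>0. norm (E a (J a) (f - F a)) \<le> norm (F a - f)"
        using proj_norm_le[of _ _ "f - F _"] by (simp add: norm_minus_commute)
    qed
    \<comment> \<open>\<open>E f - f\<close> is \<open>E (f - F) - (F - E F) + (F - f)\<close>,
      where \<open>E\<close> abbreviates \<open>E a (J a)\<close>; each part tends to 0.\<close>
    from tendsto_add[OF tendsto_diff[OF this residual] F] show ?thesis
      by (simp add: proj_diff)
  qed
  have on_range: "((\<lambda>a. E a (J a) (g - of_real l\<^sub>0 *\<^sub>C h)) \<longlongrightarrow> 0) (at a\<^sub>0)"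
    if hg: "(h, g) \<in> H u a\<^sub>0" for h g
  proof (rule Lim_null_comparison)
    define X where "X = cinner h (abs_L2 u) *\<^sub>C abs_L2 u"
    have "((\<lambda>a. (t a + d a) * norm h + s a * norm X) \<longlongrightarrow> (0 + 0) * norm h + 0 * norm X) (at a\<^sub>0)"
      by (intro tendsto_intros s t d)
    then show "((\<lambda>a. (t a + d a) * norm h + s a * norm X) \<longlongrightarrow> 0) (at a\<^sub>0)" by simp
    show "\<forall>\<^sub>F a in at a\<^sub>0. norm (E a (J a) (g - of_real l\<^sub>0 *\<^sub>C h))
        \<le> (t a + d a) * norm h + s a * norm X"
      using good
    proof eventually_elim
      case (elim a)
      \<comment> \<open>\<open>g'\<close> is the image of \<open>h\<close> under
        \<open>H u a\<close>, so \<open>proj_near_le\<close> applies to it: \<open>J a\<close> lies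
        within \<open>t a + d a\<close> of \<open>l\<^sub>0\<close>. The change from
        \<open>g\<close> to \<open>g'\<close> has norm \<open>s a * norm X\<close>.\<close>
      define g' where "g' = g + (a - a\<^sub>0) *\<^sub>R X"
      have "(h, g') \<in> H u a"
        using hg unfolding H_iff X_def[symmetric] g'_def scaleC_of_real by (simp add: algebra_simps)
      then have "norm (E a (J a) (g' - of_real l\<^sub>0 *\<^sub>C h)) \<le> (t a + d a) * norm h"
        by (rule spectral_resolution.proj_near_le[OF sr]) (use elim J in \<open>auto simp: J_def\<close>)
      moreover have "norm (E a (J a) ((a - a\<^sub>0) *\<^sub>R X)) \<le> s a * norm X"
        using proj_norm_le[of a a "(a - a\<^sub>0) *\<^sub>R X"] by (simp add: s_def)
      moreover have "g - of_real l\<^sub>0 *\<^sub>C h = (g' - of_real l\<^sub>0 *\<^sub>C h) - (a - a\<^sub>0) *\<^sub>R X"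
        by (simp add: g'_def)
      then have "norm (E a (J a) (g - of_real l\<^sub>0 *\<^sub>C h))
          \<le> norm (E a (J a) (g' - of_real l\<^sub>0 *\<^sub>C h)) + norm (E a (J a) ((a - a\<^sub>0) *\<^sub>R X))"
        by (simp only: proj_diff norm_triangle_ineq4)
      ultimately show ?case by linarith
    qed
  qed
  have on_orthogonal: "((\<lambda>a. E a (J a) g) \<longlongrightarrow> 0) (at a\<^sub>0)" "E a\<^sub>0 {l\<^sub>0} g = 0"
    if g: "cinner g f = 0" for g
  proof -
    obtain h w where hw: "\<And>j. (h j, w j) \<in> H u a\<^sub>0" "(\<lambda>j. w j - of_real l\<^sub>0 *\<^sub>C h j) \<longlonglongrightarrow> g"
      using range_dense[OF g[unfolded f_def], of a\<^sub>0] by blast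
    show "((\<lambda>a. E a (J a) g) \<longlongrightarrow> 0) (at a\<^sub>0)"
      by (rule contractions_tendsto_0[OF _ _ hw(2)])
         (use proj_norm_le proj_diff on_range[OF hw(1)] in auto)
    \<comment> \<open>A constant family tending to 0 is 0; this reuses the approximation argument
      for the single projection onto the eigenspace.\<close>
    have "((\<lambda>_::nat. E a\<^sub>0 {l\<^sub>0} g) \<longlonglongrightarrow> 0)"
      by (rule contractions_tendsto_0[OF _ _ hw(2)])
         (auto simp: spectral_resolution.proj_point_range[OF sr hw(1)]
           intro!: spectral_resolution.proj_norm_le[OF sr] spectral_resolution.proj_diff[OF sr])
    then show "E a\<^sub>0 {l\<^sub>0} g = 0" by (simp add: LIMSEQ_const_iff)
  qed
  have eigen: "(f, of_real l\<^sub>0 *\<^sub>C f) \<in> H u a\<^sub>0" unfolding f_def by (rule eigenvector[OF root])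
  have limit: "((\<lambda>a. E a (J a) g) \<longlongrightarrow> E a\<^sub>0 {l\<^sub>0} g) (at a\<^sub>0)" for g
  proof -
    \<comment> \<open>Coefficient of the orthogonal projection of \<open>g\<close> onto the line of
      \<open>f\<close>; the remainder \<open>g'\<close> falls under
      \<open>on_orthogonal\<close>.\<close>
    define c where "c = cinner g f / of_real m"
    define g' where "g' = g - c *\<^sub>C f"
    have "cinner f f = of_real m" using norm_f\<^sub>0 cinner_self_norm[of f] by (simp add: f_def)
    then have g': "cinner g' f = 0" using m by (simp add: g'_def c_def cinner_simps)
    have g_eq: "g = c *\<^sub>C f + g'" by (simp add: g'_def)
    have "((\<lambda>a. c *\<^sub>C (E a (J a) f - f)) \<longlongrightarrow> 0) (at a\<^sub>0)"
      by (rule tendsto_norm_zero_cancel)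
         (simp add: norm_scaleC tendsto_mult_right_zero tendsto_norm_zero on_f)
    from tendsto_add[OF tendsto_add[OF this tendsto_const[of "c *\<^sub>C f"]] on_orthogonal(1)[OF g']]
    have "((\<lambda>a. c *\<^sub>C (E a (J a) f - f) + c *\<^sub>C f + E a (J a) g') \<longlongrightarrow> c *\<^sub>C f) (at a\<^sub>0)" by simp
    also have "(\<lambda>a. c *\<^sub>C (E a (J a) f - f) + c *\<^sub>C f + E a (J a) g') = (\<lambda>a. E a (J a) g)"
      by (subst g_eq) (simp add: proj_add proj_scaleC scaleC_add_right[symmetric])
    also have "c *\<^sub>C f = E a\<^sub>0 {l\<^sub>0} g"
      by (subst g_eq) (simp add: spectral_resolution.proj_add[OF sr]
        spectral_resolution.proj_scaleC[OF sr] on_orthogonal(2)[OF g']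
        spectral_resolution.proj_eigenvector[OF sr eigen])
    finally show ?thesis .
  qed
  have "((\<lambda>a. emeasure lborel (J a)) \<longlongrightarrow> 0) (at a\<^sub>0)"
    unfolding emJ using tendsto_ennrealI[OF tendsto_mult_right_zero[OF d, of 2]] by simp
  moreover have "((\<lambda>a. emeasure lborel (J a) / ennreal (\<bar>a - a\<^sub>0\<bar> powr p)) \<longlongrightarrow> 0) (at a\<^sub>0)"
  proof (rule Lim_transform_eventually)
    have "((\<lambda>a. s a powr (r - p)) \<longlongrightarrow> 0) (at a\<^sub>0)" using r by (intro s_powr) simp
    from tendsto_ennrealI[OF tendsto_mult_right_zero[OF this, of 2]]
    show "((\<lambda>a. ennreal (2 * s a powr (r - p))) \<longlongrightarrow> 0) (at a\<^sub>0)" by simp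
    show "\<forall>\<^sub>F a in at a\<^sub>0. ennreal (2 * s a powr (r - p))
        = emeasure lborel (J a) / ennreal (\<bar>a - a\<^sub>0\<bar> powr p)"
      using s_pos
      by eventually_elim (simp add: emJ d_def s_def[symmetric] divide_ennreal powr_diff)
  qed
  moreover have "f \<noteq> 0" using norm_f\<^sub>0 m by (auto simp: f_def)
  then have "eigenvalue (H u a\<^sub>0) l\<^sub>0" using eigen unfolding eigenvalue_def by blast
  ultimately show ?thesis
    unfolding spectrum_concentrated_def using selfadjoint_H spec J limit by blast
qed

end

theorem corollary4p6:
  fixes a\<^sub>0 l\<^sub>0 p :: real and u :: "real \<Rightarrow> complex" and n :: nat
    and E :: "real \<Rightarrow> real set \<Rightarrow> L2 \<Rightarrow> L2"
  assumes "schwartz u"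
    and "norm (abs_L2 u) = 1"
    and "\<And>x. u x = 0 \<longleftrightarrow> x = l\<^sub>0"
    and "1 + of_real a\<^sub>0 * pv_integral (\<lambda>x. of_real ((cmod (u x))\<^sup>2)) l\<^sub>0 = 0"
    and "n \<ge> 1"
    and "vanishes_to_order u n l\<^sub>0"
    and "0 \<le> p" and "p < 2 * real n"
    and "\<And>a. spectral_measure (H u a) (E a)"
  shows "spectrum_concentrated (H u) E l\<^sub>0 a\<^sub>0 p"
proof -
  obtain k where k: "n = Suc k" using assms(5) by (cases n) auto
  obtain K where K: "0 \<le> K" "\<And>x. cmod (u x) \<le> K * \<bar>x - l\<^sub>0\<bar> ^ n"
    using vanishes_to_order_bound[OF assms(1,6)] by blast
  \<comment> \<open>A zero of order \<open>n \<ge> 1\<close> also has order 1, which supplies the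
    linear bound with its own constant \<open>V\<close>.\<close>
  have "vanishes_to_order u 1 l\<^sub>0" using assms(5,6) by (auto simp: vanishes_to_order_def)
  then obtain V where V: "0 \<le> V" "\<And>x. cmod (u x) \<le> V * \<bar>x - l\<^sub>0\<bar> ^ 1"
    using vanishes_to_order_bound[OF assms(1)] by blast
  interpret vanishing_vector u l\<^sub>0 K V k
    by unfold_locales (use schwartz_square_integrable[OF assms(1)] K V in \<open>auto simp: k\<close>)
  have "complex_of_real (1 + a\<^sub>0 * \<Gamma>\<^sub>0) = 0"
    using assms(4) unfolding pv_integral_eq by simp
  then have "1 + a\<^sub>0 * \<Gamma>\<^sub>0 = 0" by (simp only: of_real_eq_0_iff)
  then have "a\<^sub>0 * \<Gamma>\<^sub>0 = -1" by simp
  then show ?thesis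
    using assms(2,8,9) by (intro spectrum_concentrated_H) (auto simp: k)
qed

end
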